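(* Let $R$ be a ring and let $S$ be a multiplicatively closed set in $R$ such that the localization $R_S$ is semi-local. Then at least one of the following holds. (1) $R_S$ is submaximal. (2) $\mathrm{Spec}(R_S)=\mathrm{Max}(R_S)=\{P_S\mid P\in\mathcal{M}\}$, where $\mathcal{M}$ is a finite subset of $\mathrm{Min}(R)\cap \mathrm{Max}(R)$. In particular, if (2) holds and $R_S$ is submaximal, then $R$ is submaximal too.
   Context: All rings (including $R_S$) are commutative with $1\neq 0$, and a subring of a ring contains the identity of that ring. A maximal subring of $R$ is a proper subring $T\subsetneq R$ such that there is no subring strictly between $T$ and $R$; $R$ is called submaximal if it has at least one maximal subring. A ring is semi-local if it has only finitely many maximal ideals (it need not be noetherian). $\mathrm{Spec}(R)$, $\mathrm{Max}(R)$ and $\mathrm{Min}(R)$ are the sets of prime, maximal and minimal prime ideals of $R$. $R_S$ is the localization of $R$ at $S$, and for an ideal $P$ of $R$, $P_S$ is the extension of $P$ to $R_S$. *)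

theory Defs
  imports "HOL-Algebra.Algebra"
begin

section \<open>Localization of a commutative ring\<close>

text \<open>
  Let \<open>S\<close> be a multiplicatively closed set of \<open>R\<close>, i.e. a submonoid of \<open>(R, \<cdot>)\<close>. The fraction
  \<open>a/s\<close> is the class of the pair \<open>(a, s) \<in> R \<times> S\<close> under
  \<open>(a, s) \<sim> (b, t) \<longleftrightarrow> (\<exists>u \<in> S. u a t = u b s)\<close>. The factor \<open>u\<close> is needed since \<open>S\<close> may contain zero
  divisors.
\<close>

definition loc_frac :: "('a, 'b) ring_scheme \<Rightarrow> 'a set \<Rightarrow> 'a \<Rightarrow> 'a \<Rightarrow> ('a \<times> 'a) set" where
  "loc_frac R S a s =
    {(b, t). b \<in> carrier R \<and> t \<in> S \<and>
      (\<exists>u\<in>S. u \<otimes>\<^bsub>R\<^esub> (a \<otimes>\<^bsub>R\<^esub> t) = u \<otimes>\<^bsub>R\<^esub> (b \<otimes>\<^bsub>R\<^esub> s))}"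

text \<open>
  The unions below range over all representatives of the operands; they are unions of equal
  classes, see \<open>localization_mult\<close> and \<open>localization_add\<close>.
\<close>

definition localization :: "('a, 'b) ring_scheme \<Rightarrow> 'a set \<Rightarrow> ('a \<times> 'a) set ring" where
  "localization R S =
    \<lparr>carrier = {loc_frac R S a s | a s. a \<in> carrier R \<and> s \<in> S},
     monoid.mult = (\<lambda>A B. \<Union>(a, s)\<in>A. \<Union>(b, t)\<in>B. loc_frac R S (a \<otimes>\<^bsub>R\<^esub> b) (s \<otimes>\<^bsub>R\<^esub> t)),
     monoid.one = loc_frac R S \<one>\<^bsub>R\<^esub> \<one>\<^bsub>R\<^esub>,
     ring.zero = loc_frac R S \<zero>\<^bsub>R\<^esub> \<one>\<^bsub>R\<^esub>,
     ring.add = (\<lambda>A B. \<Union>(a, s)\<in>A. \<Union>(b, t)\<in>B.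
       loc_frac R S ((a \<otimes>\<^bsub>R\<^esub> t) \<oplus>\<^bsub>R\<^esub> (b \<otimes>\<^bsub>R\<^esub> s)) (s \<otimes>\<^bsub>R\<^esub> t))\<rparr>"

definition loc_map :: "('a, 'b) ring_scheme \<Rightarrow> 'a set \<Rightarrow> 'a \<Rightarrow> ('a \<times> 'a) set" where
  "loc_map R S a = loc_frac R S a \<one>\<^bsub>R\<^esub>"

definition loc_extension :: "('a, 'b) ring_scheme \<Rightarrow> 'a set \<Rightarrow> 'a set \<Rightarrow> ('a \<times> 'a) set set" where
  "loc_extension R S P = Idl\<^bsub>localization R S\<^esub> (loc_map R S ` P)"

section \<open>Spectra and maximal subrings\<close>

definition Spec :: "('a, 'b) ring_scheme \<Rightarrow> 'a set set" where
  "Spec R = {P. primeideal P R}"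

definition MaxSpec :: "('a, 'b) ring_scheme \<Rightarrow> 'a set set" where
  "MaxSpec R = {M. maximalideal M R}"

definition MinSpec :: "('a, 'b) ring_scheme \<Rightarrow> 'a set set" where
  "MinSpec R = {P \<in> Spec R. \<forall>Q\<in>Spec R. Q \<subseteq> P \<longrightarrow> Q = P}"

definition semi_local :: "('a, 'b) ring_scheme \<Rightarrow> bool" where
  "semi_local R \<longleftrightarrow> finite (MaxSpec R)"

definition maximal_subring :: "'a set \<Rightarrow> ('a, 'b) ring_scheme \<Rightarrow> bool" where
  "maximal_subring T R \<longleftrightarrow> subring T R \<and> T \<subset> carrier R \<and>
    \<not> (\<exists>U. subring U R \<and> T \<subset> U \<and> U \<subset> carrier R)"

definition submaximal :: "('a, 'b) ring_scheme \<Rightarrow> bool" where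
  "submaximal R \<longleftrightarrow> (\<exists>T. maximal_subring T R)"

text \<open>
  \<open>Spec(R\<^sub>S) = Max(R\<^sub>S) = {P\<^sub>S | P \<in> \<M>}\<close> for some finite subset \<open>\<M>\<close> of \<open>Min(R) \<inter> Max(R)\<close>.
\<close>

definition loc_spec_finite_min_max :: "('a, 'b) ring_scheme \<Rightarrow> 'a set \<Rightarrow> bool" where
  "loc_spec_finite_min_max R S \<longleftrightarrow>
    (\<exists>\<M>. finite \<M> \<and> \<M> \<subseteq> MinSpec R \<inter> MaxSpec R \<and>
      Spec (localization R S) = MaxSpec (localization R S) \<and>
      MaxSpec (localization R S) = {loc_extension R S P | P. P \<in> \<M>})"

section \<open>The localization is a commutative ring\<close>

locale mult_closed = cring R + submonoid S R for R (structure) and S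
begin

lemma S_carr [simp, intro]: "s \<in> S \<Longrightarrow> s \<in> carrier R"
  using subset by blast

lemma loc_frac_iff:
  assumes "a \<in> carrier R" "s \<in> S" "b \<in> carrier R" "t \<in> S"
  shows "loc_frac R S a s = loc_frac R S b t \<longleftrightarrow> (\<exists>u\<in>S. u \<otimes> (a \<otimes> t) = u \<otimes> (b \<otimes> s))"
proof
  assume "loc_frac R S a s = loc_frac R S b t"
  moreover have "(b, t) \<in> loc_frac R S b t"
    using assms one_closed unfolding loc_frac_def by blast
  ultimately show "\<exists>u\<in>S. u \<otimes> (a \<otimes> t) = u \<otimes> (b \<otimes> s)"
    unfolding loc_frac_def by blast
next
  assume "\<exists>u\<in>S. u \<otimes> (a \<otimes> t) = u \<otimes> (b \<otimes> s)"
  moreover have sub: "loc_frac R S b t \<subseteq> loc_frac R S a s"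
    if ab: "a \<in> carrier R" "s \<in> S" "b \<in> carrier R" "t \<in> S"
      and u: "u \<in> S" "u \<otimes> (a \<otimes> t) = u \<otimes> (b \<otimes> s)" for a s b t u
  proof
    fix p assume "p \<in> loc_frac R S b t"
    then obtain c r v where c: "p = (c, r)" "c \<in> carrier R" "r \<in> S" "v \<in> S"
      "v \<otimes> (b \<otimes> r) = v \<otimes> (c \<otimes> t)"
      unfolding loc_frac_def by auto
    have "(u \<otimes> v \<otimes> t) \<otimes> (a \<otimes> r) = (v \<otimes> r) \<otimes> (u \<otimes> (a \<otimes> t))"
      using ab u(1) c(2-4) by (simp add: m_ac)
    also have "\<dots> = (u \<otimes> s) \<otimes> (v \<otimes> (b \<otimes> r))"
      unfolding u(2) using ab u(1) c(2-4) by (simp add: m_ac)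
    also have "\<dots> = (u \<otimes> v \<otimes> t) \<otimes> (c \<otimes> s)"
      unfolding c(5) using ab u(1) c(2-4) by (simp add: m_ac)
    finally show "p \<in> loc_frac R S a s"
      using ab u(1) c(1-4) unfolding loc_frac_def by blast
  qed
  ultimately show "loc_frac R S a s = loc_frac R S b t"
    using sub assms by (metis subset_antisym)
qed

lemma loc_fracE:
  assumes "p \<in> loc_frac R S a s" "a \<in> carrier R" "s \<in> S"
  obtains b t where "p = (b, t)" "b \<in> carrier R" "t \<in> S" "loc_frac R S b t = loc_frac R S a s"
proof -
  obtain b t where p: "p = (b, t)" "b \<in> carrier R" "t \<in> S"
      "\<exists>u\<in>S. u \<otimes> (a \<otimes> t) = u \<otimes> (b \<otimes> s)"
    using assms unfolding loc_frac_def by blast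
  then have "loc_frac R S a s = loc_frac R S b t"
    using loc_frac_iff assms by blast
  then show thesis using p that by simp
qed

lemma self_mem: "\<lbrakk>a \<in> carrier R; s \<in> S\<rbrakk> \<Longrightarrow> (a, s) \<in> loc_frac R S a s"
  using one_closed unfolding loc_frac_def by blast

lemma loc_frac_mult_cong:
  assumes c: "a \<in> carrier R" "s \<in> S" "b \<in> carrier R" "t \<in> S"
    "a' \<in> carrier R" "s' \<in> S" "b' \<in> carrier R" "t' \<in> S"
    and e: "loc_frac R S a' s' = loc_frac R S a s" "loc_frac R S b' t' = loc_frac R S b t"
  shows "loc_frac R S (a' \<otimes> b') (s' \<otimes> t') = loc_frac R S (a \<otimes> b) (s \<otimes> t)"
    and "loc_frac R S ((a' \<otimes> t') \<oplus> (b' \<otimes> s')) (s' \<otimes> t') =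
      loc_frac R S ((a \<otimes> t) \<oplus> (b \<otimes> s)) (s \<otimes> t)"
proof -
  obtain u v where u: "u \<in> S" "u \<otimes> (a' \<otimes> s) = u \<otimes> (a \<otimes> s')"
    and v: "v \<in> S" "v \<otimes> (b' \<otimes> t) = v \<otimes> (b \<otimes> t')"
    using e c loc_frac_iff by metis
  have uv: "u \<otimes> v \<in> S" using u v by simp
  have "(u \<otimes> v) \<otimes> ((a' \<otimes> b') \<otimes> (s \<otimes> t)) = (u \<otimes> (a' \<otimes> s)) \<otimes> (v \<otimes> (b' \<otimes> t))"
    using c u(1) v(1) by (simp add: m_ac)
  also have "\<dots> = (u \<otimes> v) \<otimes> ((a \<otimes> b) \<otimes> (s' \<otimes> t'))"
    unfolding u(2) v(2) using c u(1) v(1) by (simp add: m_ac)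
  finally show "loc_frac R S (a' \<otimes> b') (s' \<otimes> t') = loc_frac R S (a \<otimes> b) (s \<otimes> t)"
    using uv c by (subst loc_frac_iff) auto
  have "(u \<otimes> v) \<otimes> (((a' \<otimes> t') \<oplus> (b' \<otimes> s')) \<otimes> (s \<otimes> t))
      = (v \<otimes> t' \<otimes> t) \<otimes> (u \<otimes> (a' \<otimes> s)) \<oplus> (u \<otimes> s' \<otimes> s) \<otimes> (v \<otimes> (b' \<otimes> t))"
    using c u(1) v(1) by (simp add: m_ac r_distr l_distr)
  also have "\<dots> = (u \<otimes> v) \<otimes> (((a \<otimes> t) \<oplus> (b \<otimes> s)) \<otimes> (s' \<otimes> t'))"
    unfolding u(2) v(2) using c u(1) v(1) by (simp add: m_ac r_distr l_distr)
  finally show "loc_frac R S ((a' \<otimes> t') \<oplus> (b' \<otimes> s')) (s' \<otimes> t') =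
      loc_frac R S ((a \<otimes> t) \<oplus> (b \<otimes> s)) (s \<otimes> t)"
    using uv c by (subst loc_frac_iff) auto
qed

lemma UN_const:
  assumes c: "a \<in> carrier R" "s \<in> S" "b \<in> carrier R" "t \<in> S"
    and h: "\<And>a' s' b' t'. \<lbrakk>a' \<in> carrier R; s' \<in> S; b' \<in> carrier R; t' \<in> S;
      loc_frac R S a' s' = loc_frac R S a s; loc_frac R S b' t' = loc_frac R S b t\<rbrakk>
      \<Longrightarrow> f a' s' b' t' = f a s b t"
  shows "(\<Union>(a', s')\<in>loc_frac R S a s. \<Union>(b', t')\<in>loc_frac R S b t. f a' s' b' t') = f a s b t"
proof (intro equalityI subsetI)
  fix x assume "x \<in> (\<Union>(a', s')\<in>loc_frac R S a s. \<Union>(b', t')\<in>loc_frac R S b t. f a' s' b' t')"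
  then obtain a' s' b' t' where p: "(a', s') \<in> loc_frac R S a s" "(b', t') \<in> loc_frac R S b t"
    "x \<in> f a' s' b' t'" by auto
  have "a' \<in> carrier R \<and> s' \<in> S \<and> loc_frac R S a' s' = loc_frac R S a s"
    using loc_fracE[OF p(1) c(1,2)] by blast
  moreover have "b' \<in> carrier R \<and> t' \<in> S \<and> loc_frac R S b' t' = loc_frac R S b t"
    using loc_fracE[OF p(2) c(3,4)] by blast
  ultimately show "x \<in> f a s b t" using h p(3) by blast
next
  fix x assume "x \<in> f a s b t"
  then show "x \<in> (\<Union>(a', s')\<in>loc_frac R S a s. \<Union>(b', t')\<in>loc_frac R S b t. f a' s' b' t')"
    using self_mem[OF c(1,2)] self_mem[OF c(3,4)] by blast
qed

lemma localization_mult: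
  assumes "a \<in> carrier R" "s \<in> S" "b \<in> carrier R" "t \<in> S"
  shows "loc_frac R S a s \<otimes>\<^bsub>localization R S\<^esub> loc_frac R S b t = loc_frac R S (a \<otimes> b) (s \<otimes> t)"
  unfolding localization_def
  using UN_const[OF assms, of "\<lambda>a s b t. loc_frac R S (a \<otimes> b) (s \<otimes> t)"]
    loc_frac_mult_cong(1)[OF assms] by simp

lemma localization_add:
  assumes "a \<in> carrier R" "s \<in> S" "b \<in> carrier R" "t \<in> S"
  shows "loc_frac R S a s \<oplus>\<^bsub>localization R S\<^esub> loc_frac R S b t =
    loc_frac R S ((a \<otimes> t) \<oplus> (b \<otimes> s)) (s \<otimes> t)"
  unfolding localization_def
  using UN_const[OF assms, of "\<lambda>a s b t. loc_frac R S ((a \<otimes> t) \<oplus> (b \<otimes> s)) (s \<otimes> t)"]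
    loc_frac_mult_cong(2)[OF assms] by simp

lemma localization_carrier:
  "carrier (localization R S) = {loc_frac R S a s | a s. a \<in> carrier R \<and> s \<in> S}"
  by (simp add: localization_def)

lemma localization_one: "\<one>\<^bsub>localization R S\<^esub> = loc_frac R S \<one> \<one>"
  by (simp add: localization_def)

lemma localization_zero: "\<zero>\<^bsub>localization R S\<^esub> = loc_frac R S \<zero> \<one>"
  by (simp add: localization_def)

lemmas localization_simps =
  localization_mult localization_add localization_one localization_zero

lemma loc_frac_carrier [simp, intro]:
  "\<lbrakk>a \<in> carrier R; s \<in> S\<rbrakk> \<Longrightarrow> loc_frac R S a s \<in> carrier (localization R S)"
  by (auto simp: localization_carrier)

lemma localization_carrierE:
  assumes "A \<in> carrier (localization R S)"
  obtains a s where "A = loc_frac R S a s" "a \<in> carrier R" "s \<in> S"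
  using assms by (auto simp: localization_carrier)

lemma loc_frac_eqI:
  assumes "a \<in> carrier R" "s \<in> S" "b \<in> carrier R" "t \<in> S" "a \<otimes> t = b \<otimes> s"
  shows "loc_frac R S a s = loc_frac R S b t"
  using assms one_closed by (auto simp: loc_frac_iff)

lemma localization_cring: "cring (localization R S)"
proof (rule cringI)
  show "abelian_group (localization R S)"
  proof (rule abelian_groupI)
    fix A assume "A \<in> carrier (localization R S)"
    then obtain a s where A: "A = loc_frac R S a s" "a \<in> carrier R" "s \<in> S"
      by (auto simp: localization_carrier)
    then have "loc_frac R S (\<ominus> a) s \<oplus>\<^bsub>localization R S\<^esub> A = \<zero>\<^bsub>localization R S\<^esub>"
      by (simp add: localization_simps l_minus l_neg) (rule loc_frac_eqI, simp_all)
    moreover have "loc_frac R S (\<ominus> a) s \<in> carrier (localization R S)" using A by simp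
    ultimately show
      "\<exists>B\<in>carrier (localization R S). B \<oplus>\<^bsub>localization R S\<^esub> A = \<zero>\<^bsub>localization R S\<^esub>"
      by blast
  qed (auto elim!: localization_carrierE simp: localization_simps m_ac a_ac l_distr r_distr
        intro!: loc_frac_eqI)
next
  show "Group.comm_monoid (localization R S)"
    by (rule comm_monoidI)
      (auto elim!: localization_carrierE simp: localization_simps m_ac intro!: loc_frac_eqI)
next
  fix A B C
  assume "A \<in> carrier (localization R S)" "B \<in> carrier (localization R S)"
    "C \<in> carrier (localization R S)"
  then show "(A \<oplus>\<^bsub>localization R S\<^esub> B) \<otimes>\<^bsub>localization R S\<^esub> C =
      (A \<otimes>\<^bsub>localization R S\<^esub> C) \<oplus>\<^bsub>localization R S\<^esub> (B \<otimes>\<^bsub>localization R S\<^esub> C)"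
    by (elim localization_carrierE, simp add: localization_simps)
      (rule loc_frac_eqI, simp_all add: m_ac l_distr r_distr)
qed

lemma loc_map_hom: "loc_map R S \<in> ring_hom R (localization R S)"
  by (rule ring_hom_memI)
    (auto simp: loc_map_def localization_simps intro!: loc_frac_eqI)

lemma loc_map_Units:
  assumes "s \<in> S"
  shows "loc_map R S s \<in> Units (localization R S)"
proof -
  interpret L: cring "localization R S" by (rule localization_cring)
  have "loc_map R S s \<otimes>\<^bsub>localization R S\<^esub> loc_frac R S \<one> s = \<one>\<^bsub>localization R S\<^esub>"
    using assms by (simp add: loc_map_def localization_simps) (rule loc_frac_eqI, simp_all)
  moreover have "loc_map R S s \<in> carrier (localization R S)"
      "loc_frac R S \<one> s \<in> carrier (localization R S)"
    using assms by (auto simp: loc_map_def)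
  ultimately show ?thesis
    unfolding Units_def using L.m_comm by (smt (verit, best) mem_Collect_eq)
qed

end

end

theory Submission
  imports Defs
begin

text \<open>
  If \<open>A\<close> is a subring of \<open>T\<close> and \<open>z \<in> T - A\<close> satisfies \<open>T = A[z]\<close>, then by Zorn's lemma \<open>T\<close> has
  a maximal subring. Now let \<open>h : T \<rightarrow> K\<close> be a homomorphism to a field and let \<open>p, z \<in> T\<close> with
  \<open>h p * h z = 1\<close>. If \<open>h p\<close> is the uniformizer of some discrete valuation ring in \<open>K\<close>, then \<open>K\<close>
  has a valuation ring \<open>V\<close> of rank one with \<open>h p \<in> V\<close> and \<open>h z \<notin> V\<close>, and \<open>A = h\<^sup>-\<^sup>1(V)\<close> and \<open>z\<close>
  are as above. A semi-local ring \<open>T\<close> contains the inverse of some prime number \<open>p\<close>, so if \<open>T\<close> has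
  no maximal subring, then every residue field \<open>K\<close> of \<open>T\<close> has positive characteristic, and the
  images in \<open>K\<close> of elements that are invertible modulo the given prime are algebraic over the prime
  field. If a prime \<open>P\<close> of \<open>T\<close> were not maximal, this would apply to \<open>1 + x\<close> for an \<open>x \<notin> P\<close> in the
  Jacobson radical, so \<open>x\<close> would be invertible modulo \<open>P\<close>, which is absurd. For \<open>T = R\<^sub>S\<close>
  and \<open>P\<close> maximal it shows that \<open>R\<close> modulo the contraction of \<open>P\<close> is a field.

  In the situation of (2), an element \<open>s \<in> S\<close> has an inverse \<open>a\<close> modulo all \<open>P \<in> \<M>\<close>, so
  \<open>1 - a s\<close> is nilpotent in \<open>R\<^sub>S\<close> and \<open>1 / s\<close> is in the image of \<open>R\<close>. Hence \<open>R \<rightarrow> R\<^sub>S\<close> is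
  surjective and maximal subrings can be pulled back.
\<close>

section \<open>Subrings maximal with respect to avoiding an element\<close>

lemma (in ring) subring_Union_chain:
  assumes "\<C> \<noteq> {}" and "subset.chain \<A> \<C>" and "\<And>A. A \<in> \<A> \<Longrightarrow> subring A R"
  shows "subring (\<Union>\<C>) R"
proof (rule subringI)
  have sub: "subring A R" if "A \<in> \<C>" for A
    using assms that by (auto simp: pred_on.chain_def)
  have two: "\<exists>A\<in>\<C>. a \<in> A \<and> b \<in> A" if "a \<in> \<Union>\<C>" "b \<in> \<Union>\<C>" for a b
    using that assms(2) unfolding pred_on.chain_def by blast
  show "\<Union>\<C> \<subseteq> carrier R" using subringE(1)[OF sub] by auto
  show "\<one> \<in> \<Union>\<C>" using subringE(3)[OF sub] assms(1) by auto
  show "\<ominus> h \<in> \<Union>\<C>" if "h \<in> \<Union>\<C>" for h using that subringE(5)[OF sub] by auto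
  show "a \<otimes> b \<in> \<Union>\<C>" if "a \<in> \<Union>\<C>" "b \<in> \<Union>\<C>" for a b
    using two[OF that] subringE(6)[OF sub] by auto
  show "a \<oplus> b \<in> \<Union>\<C>" if "a \<in> \<Union>\<C>" "b \<in> \<Union>\<C>" for a b
    using two[OF that] subringE(7)[OF sub] by auto
qed

text \<open>Zorn's lemma. It serves twice: in a field with \<open>z = 1/y\<close> it leads to a
  valuation ring, and in a ring generated by \<open>A\<close> and \<open>z\<close> it leads to a
  maximal subring.\<close>

lemma (in ring) subring_maximal_avoiding:
  assumes "subring A R" and "z \<notin> A"
  obtains V where "subring V R" "A \<subseteq> V" "z \<notin> V"
    "\<And>U. \<lbrakk>subring U R; V \<subseteq> U; z \<notin> U\<rbrakk> \<Longrightarrow> U = V"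
proof -
  define F where "F = {V. subring V R \<and> A \<subseteq> V \<and> z \<notin> V}"
  have "\<exists>M\<in>F. \<forall>Z\<in>F. M \<subseteq> Z \<longrightarrow> Z = M"
  proof (rule subset_Zorn_nonempty)
    show "F \<noteq> {}" using assms by (auto simp: F_def)
    fix \<C> assume C: "\<C> \<noteq> {}" "subset.chain F \<C>"
    then have "subring (\<Union>\<C>) R" by (rule subring_Union_chain) (simp add: F_def)
    moreover have "\<C> \<subseteq> F" using C(2) by (simp add: pred_on.chain_def)
    ultimately show "\<Union>\<C> \<in> F" using C(1) by (auto simp: F_def)
  qed
  then show thesis using that by (auto simp: F_def)
qed

lemma (in ring) subring_nat_pow:
  assumes "subring A R" "a \<in> A"
  shows "a [^] (n::nat) \<in> A"
  using subringE[OF assms(1)] assms(2) by (induction n) auto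

lemma (in ring) subring_minus:
  assumes "subring A R" "a \<in> A" "b \<in> A"
  shows "a \<ominus> b \<in> A"
  using subringE[OF assms(1)] assms(2,3) by (simp add: a_minus_def)

section \<open>Polynomial expressions with a bound on the degree\<close>

text \<open>In Horner form, the values at \<open>x\<close> of the polynomials of degree at most
  \<open>n\<close> over \<open>A\<close>. The index keeps track of the degree, which decreases in
  the descent of \<open>no_two_expansions\<close>.\<close>

primrec poly_values :: "('a, 'b) ring_scheme \<Rightarrow> 'a set \<Rightarrow> 'a \<Rightarrow> nat \<Rightarrow> 'a set" where
  "poly_values R A x 0 = A" |
  "poly_values R A x (Suc n) = {h \<otimes>\<^bsub>R\<^esub> x \<oplus>\<^bsub>R\<^esub> a | h a. h \<in> poly_values R A x n \<and> a \<in> A}"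

lemma poly_values_SucI:
  "\<lbrakk>h \<in> poly_values R A x n; a \<in> A\<rbrakk> \<Longrightarrow> h \<otimes>\<^bsub>R\<^esub> x \<oplus>\<^bsub>R\<^esub> a \<in> poly_values R A x (Suc n)"
  by auto

lemma poly_values_SucE:
  assumes "g \<in> poly_values R A x (Suc n)"
  obtains h a where "h \<in> poly_values R A x n" "a \<in> A" "g = h \<otimes>\<^bsub>R\<^esub> x \<oplus>\<^bsub>R\<^esub> a"
  using assms by auto

context cring
begin

lemma poly_values_closed:
  assumes "subring A R" "x \<in> carrier R" "h \<in> poly_values R A x n"
  shows "h \<in> carrier R"
  using assms(3) subringE(1)[OF assms(1)] assms(2) by (induction n arbitrary: h) auto

lemma poly_values_add:
  assumes A: "subring A R" and x: "x \<in> carrier R"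
    and "g \<in> poly_values R A x n" "h \<in> poly_values R A x n"
  shows "g \<oplus> h \<in> poly_values R A x n"
  using assms(3,4)
proof (induction n arbitrary: g h)
  case 0
  then show ?case using subringE(7)[OF A] by simp
next
  case (Suc n)
  then obtain g' a h' b where g: "g = g' \<otimes> x \<oplus> a" "g' \<in> poly_values R A x n" "a \<in> A"
    and h: "h = h' \<otimes> x \<oplus> b" "h' \<in> poly_values R A x n" "b \<in> A" by auto
  have "g' \<in> carrier R" "h' \<in> carrier R" "a \<in> carrier R" "b \<in> carrier R"
    using g h poly_values_closed[OF A x] subringE(1)[OF A] by auto
  then have "g \<oplus> h = (g' \<oplus> h') \<otimes> x \<oplus> (a \<oplus> b)"
    unfolding g h using x by algebra
  then show ?case using Suc.IH g h subringE(7)[OF A] by (metis poly_values_SucI)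
qed

lemma poly_values_smult:
  assumes A: "subring A R" and x: "x \<in> carrier R"
    and "c \<in> A" "h \<in> poly_values R A x n"
  shows "c \<otimes> h \<in> poly_values R A x n"
  using assms(4)
proof (induction n arbitrary: h)
  case 0
  then show ?case using subringE(6)[OF A] assms(3) by simp
next
  case (Suc n)
  then obtain h' b where h: "h = h' \<otimes> x \<oplus> b" "h' \<in> poly_values R A x n" "b \<in> A" by auto
  have "h' \<in> carrier R" "b \<in> carrier R" "c \<in> carrier R"
    using h poly_values_closed[OF A x] subringE(1)[OF A] assms(3) by auto
  then have "c \<otimes> h = (c \<otimes> h') \<otimes> x \<oplus> c \<otimes> b"
    unfolding h using x by algebra
  then show ?case using Suc.IH h subringE(6)[OF A] assms(3) by (metis poly_values_SucI)
qed

lemma poly_values_Suc: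
  assumes A: "subring A R" and x: "x \<in> carrier R" and "h \<in> poly_values R A x n"
  shows "h \<in> poly_values R A x (Suc n)"
  using assms(3)
proof (induction n arbitrary: h)
  case 0
  then have "h = \<zero> \<otimes> x \<oplus> h" using subringE(1)[OF A] x by auto
  then show ?case using subringE(2)[OF A] 0 by auto
next
  case (Suc n)
  then obtain h' b where h: "h = h' \<otimes> x \<oplus> b" "h' \<in> poly_values R A x n" "b \<in> A" by auto
  then show ?case using Suc.IH[OF h(2)] by (subst poly_values.simps) blast
qed

lemma poly_values_pow:
  assumes A: "subring A R" and x: "x \<in> carrier R" and a: "a \<in> A"
  shows "a \<otimes> x [^] n \<in> poly_values R A x n"
proof (induction n)
  case 0
  then show ?case using a subringE(1)[OF A] by auto
next
  case (Suc n)
  have "a \<in> carrier R" using a subringE(1)[OF A] by auto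
  then have "a \<otimes> x [^] Suc n = (a \<otimes> x [^] n) \<otimes> x \<oplus> \<zero>"
    using x by (simp add: m_assoc)
  then show ?case using Suc subringE(2)[OF A] by auto
qed

text \<open>Horner form splits off the constant term, whereas lowering the degree means replacing
  the leading one; hence this second decomposition.\<close>

lemma poly_values_leading:
  assumes A: "subring A R" and x: "x \<in> carrier R" and "h \<in> poly_values R A x (Suc n)"
  obtains g a where "g \<in> poly_values R A x n" "a \<in> A" "h = g \<oplus> a \<otimes> x [^] Suc n"
proof -
  have "\<exists>g a. g \<in> poly_values R A x n \<and> a \<in> A \<and> h = g \<oplus> a \<otimes> x [^] Suc n"
    using assms(3)
  proof (induction n arbitrary: h)
    case 0
    then obtain h' b where h: "h = h' \<otimes> x \<oplus> b" "h' \<in> A" "b \<in> A" by auto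
    have "h' \<in> carrier R" "b \<in> carrier R" using h subringE(1)[OF A] by auto
    then have "h = b \<oplus> h' \<otimes> x [^] Suc 0" unfolding h using x by (simp add: a_comm)
    then show ?case using h by auto
  next
    case (Suc n)
    then obtain h' b where h: "h = h' \<otimes> x \<oplus> b" "h' \<in> poly_values R A x (Suc n)" "b \<in> A"
      using poly_values_SucE[OF Suc.prems] by blast
    obtain g a where g: "g \<in> poly_values R A x n" "a \<in> A" "h' = g \<oplus> a \<otimes> x [^] Suc n"
      using Suc.IH[OF h(2)] by blast
    define t where "t = x [^] Suc n"
    have c: "g \<in> carrier R" "a \<in> carrier R" "b \<in> carrier R" "t \<in> carrier R"
      using g h poly_values_closed[OF A x] subringE(1)[OF A] x by (auto simp: t_def)
    have "h = (g \<otimes> x \<oplus> b) \<oplus> a \<otimes> (t \<otimes> x)"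
      unfolding h g t_def[symmetric] using c x by algebra
    moreover have "t \<otimes> x = x [^] Suc (Suc n)" by (simp add: t_def)
    ultimately show ?case
      using g(2) poly_values_SucI[OF g(1) h(3)] by (intro exI conjI) auto
  qed
  then show thesis using that by blast
qed

text \<open>Here \<open>x'\<close> is \<open>1/x\<close>, so \<open>x [^] n\<close> turns the
  \<open>i\<close>-th power of \<open>x'\<close>, where \<open>i\<close> \<le> \<open>m\<close>
  \<le> \<open>n\<close>, into the power of \<open>x\<close> with exponent \<open>n - i\<close>. The
  coefficients appear in reverse order.\<close>

lemma poly_values_inverse:
  assumes A: "subring A R" and x: "x \<in> carrier R" "x' \<in> carrier R" "x \<otimes> x' = \<one>"
    and "h \<in> poly_values R A x' m" "m \<le> n"
  shows "x [^] n \<otimes> h \<in> poly_values R A x n"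
  using assms(5,6)
proof (induction m arbitrary: n h)
  case 0
  then have "x [^] n \<otimes> h = h \<otimes> x [^] n" using subringE(1)[OF A] x by (auto intro: m_comm)
  then show ?case using poly_values_pow[OF A x(1)] 0 by simp
next
  case (Suc m)
  then obtain n' where n: "n = Suc n'" "m \<le> n'" by (cases n) auto
  obtain h' b where h: "h = h' \<otimes> x' \<oplus> b" "h' \<in> poly_values R A x' m" "b \<in> A"
    using Suc.prems by auto
  have c: "h' \<in> carrier R" "b \<in> carrier R" "x [^] n' \<in> carrier R"
    using h poly_values_closed[OF A x(2)] subringE(1)[OF A] x by auto
  have "x [^] n \<otimes> h = (x [^] n' \<otimes> h') \<otimes> (x \<otimes> x') \<oplus> b \<otimes> (x [^] n' \<otimes> x)"
    unfolding h n nat_pow_Suc using c x(1,2) by algebra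
  then have "x [^] n \<otimes> h = x [^] n' \<otimes> h' \<oplus> b \<otimes> x [^] n"
    using c x n by simp
  moreover have "x [^] n' \<otimes> h' \<in> poly_values R A x n"
    using Suc.IH[OF h(2) n(2)] poly_values_Suc[OF A x(1)] n by simp
  ultimately show ?case
    using poly_values_add[OF A x(1)] poly_values_pow[OF A x(1) h(3)] by simp
qed

lemma simple_extension_poly_values:
  assumes A: "subring A R" and x: "x \<in> carrier R" and e: "e \<in> simple_extension A x"
  obtains n where "e \<in> poly_values R A x n"
proof -
  have "\<exists>n. e \<in> poly_values R A x n"
    using e
  proof (induction rule: simple_extension.induct)
    case zero
    then show ?case using subringE(2)[OF A] by (intro exI[of _ 0]) simp
  next
    case (lin k1 k2)
    then show ?case using poly_values_SucI by metis
  qed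
  then show thesis using that by blast
qed

end

section \<open>Subrings of a field maximal without a given inverse are valuation rings\<close>

text \<open>\<open>y'\<close> stands for \<open>1/y\<close>. Thus \<open>y\<close> is a nonunit of
  \<open>A\<close>, and \<open>A\<close> cannot be enlarged without gaining \<open>1/y\<close>. The
  aim is \<open>valuation_ring\<close>.\<close>

locale maximal_avoiding_inverse = field R for R (structure) +
  fixes A y y'
  assumes A: "subring A R" and y: "y \<in> A" and y': "y' \<in> carrier R" "y \<otimes> y' = \<one>" "y' \<notin> A"
    and maximal: "\<And>U. \<lbrakk>subring U R; A \<subseteq> U; y' \<notin> U\<rbrakk> \<Longrightarrow> U = A"
begin

lemmas A_simps = subringE(2-3,5-7)[OF A]

lemma A_carr [simp]: "a \<in> A \<Longrightarrow> a \<in> carrier R"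
  using subringE(1)[OF A] by blast

lemma extension_cases:
  assumes "x \<in> carrier R"
  shows "x \<in> A \<or> y' \<in> simple_extension A x"
  using maximal[OF simple_extension_is_subring[OF A assms]]
    simple_extension_incl[OF subringE(1)[OF A] assms] simple_extension_mem[OF A assms] by blast

lemma one_minus_pow:
  assumes a: "a \<in> A"
  shows "\<exists>b\<in>A. (\<one> \<ominus> y \<otimes> a) [^] (n::nat) = \<one> \<ominus> y \<otimes> b"
proof (induction n)
  case 0
  show ?case using y by (intro bexI[of _ \<zero>]) (simp_all add: A_simps a_minus_def)
next
  case (Suc n)
  then obtain b where b: "b \<in> A" "(\<one> \<ominus> y \<otimes> a) [^] n = \<one> \<ominus> y \<otimes> b" by blast
  have c: "a \<in> carrier R" "b \<in> carrier R" "y \<in> carrier R" using a b y by auto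
  have "(\<one> \<ominus> y \<otimes> b) \<otimes> (\<one> \<ominus> y \<otimes> a) = \<one> \<ominus> y \<otimes> (b \<oplus> a \<ominus> y \<otimes> (b \<otimes> a))"
    using c by algebra
  moreover have "b \<oplus> a \<ominus> y \<otimes> (b \<otimes> a) \<in> A"
    using a b y by (simp add: A_simps subring_minus[OF A])
  ultimately show ?case using b by auto
qed

text \<open>If \<open>c\<close> were outside \<open>A\<close>, then \<open>A[c]\<close> would
  contain \<open>1/y\<close>. Clearing denominators with a power of \<open>d = 1 - y a\<close>,
  which again has the form \<open>1 - y b\<close>, would put \<open>1/y - b\<close> and hence
  \<open>1/y\<close> into \<open>A\<close>.\<close>

lemma one_minus_unit:
  assumes a: "a \<in> A" and c: "c \<in> carrier R" "(\<one> \<ominus> y \<otimes> a) \<otimes> c = \<one>"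
  shows "c \<in> A"
proof (rule ccontr)
  assume "c \<notin> A"
  then have *: "y' \<in> simple_extension A c" using extension_cases[OF c(1)] by blast
  define d where "d = \<one> \<ominus> y \<otimes> a"
  have d: "d \<in> A" "d \<in> carrier R" "d \<otimes> c = \<one>"
    using a c y by (simp_all add: d_def A_simps subring_minus[OF A])
  \<comment> \<open>Clearing denominators: \<open>c\<close> is the inverse of \<open>d\<close>, so a
    high power of \<open>d\<close> moves any polynomial in \<open>c\<close> into
    \<open>A\<close>.\<close>
  have "\<exists>n. d [^] (n::nat) \<otimes> e \<in> A" if "e \<in> simple_extension A c" for e
    using that
  proof (induction rule: simple_extension.induct)
    case zero
    then show ?case using d A_simps by (intro exI[of _ 0]) simp
  next
    case (lin k1 k2)
    then obtain n :: nat where n: "d [^] n \<otimes> k1 \<in> A" by blast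
    define t where "t = d [^] n"
    have k: "k1 \<in> carrier R" "k2 \<in> carrier R" "t \<in> carrier R" "t \<in> A"
      using lin simple_extension_in_carrier[OF subringE(1)[OF A] c(1)] d
        subring_nat_pow[OF A] by (auto simp: t_def)
    have "d [^] Suc n \<otimes> (k1 \<otimes> c \<oplus> k2) = (t \<otimes> k1) \<otimes> (d \<otimes> c) \<oplus> (t \<otimes> d) \<otimes> k2"
      unfolding nat_pow_Suc t_def[symmetric] using k d(2) c(1) by algebra
    also have "\<dots> = t \<otimes> k1 \<oplus> (t \<otimes> d) \<otimes> k2" using d k by simp
    also have "\<dots> \<in> A" using n k d lin by (simp add: A_simps t_def)
    finally show ?case by blast
  qed
  then obtain n :: nat where n: "d [^] n \<otimes> y' \<in> A" using * by blast
  obtain b where b: "b \<in> A" "d [^] n = \<one> \<ominus> y \<otimes> b"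
    using one_minus_pow[OF a] unfolding d_def by blast
  have bc: "b \<in> carrier R" "y \<in> carrier R" using b y by auto
  have "(\<one> \<ominus> y \<otimes> b) \<otimes> y' = y' \<ominus> b \<otimes> (y \<otimes> y')" using bc y'(1) by algebra
  then have e: "d [^] n \<otimes> y' = y' \<ominus> b" using b y' bc by simp
  have "y' = (y' \<ominus> b) \<oplus> b" using bc y'(1) by algebra
  also have "\<dots> \<in> A" using n b unfolding e by (simp add: A_simps)
  finally show False using y' by simp
qed

text \<open>
  Kaplansky's argument: of two expansions of \<open>1 / y\<close>, in \<open>w\<close> and in \<open>1 / w\<close>, the shorter one
  allows to lower the degree of the longer one.
\<close>

lemma no_two_expansions:
  assumes "w \<in> carrier R" "w' \<in> carrier R" "w \<otimes> w' = \<one>"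
    and "p \<in> poly_values R A w n" "y \<otimes> p = \<one>"
    and "q \<in> poly_values R A w' m" "y \<otimes> q = \<one>"
  shows False
  using assms
proof (induction "n + m" arbitrary: n m w w' p q rule: less_induct)
  case less
  \<comment> \<open>This is the case \<open>m\<close> \<le> \<open>n\<close>; the other one follows
    by exchanging \<open>w\<close> and \<open>w'\<close>. Only \<open>n\<close> gets smaller here,
    so the induction hypothesis enters as an assumption about smaller \<open>n\<close> with
    \<open>m\<close> fixed, which both cases can discharge.\<close>
  have step: False
    if w: "w \<in> carrier R" "w' \<in> carrier R" "w \<otimes> w' = \<one>"
      and p: "p \<in> poly_values R A w n" "y \<otimes> p = \<one>"
      and q: "q \<in> poly_values R A w' m" "y \<otimes> q = \<one>"
      and IH: "\<And>n' p'. \<lbrakk>n' < n; p' \<in> poly_values R A w n'; y \<otimes> p' = \<one>\<rbrakk> \<Longrightarrow> False"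
      and le: "m \<le> n" for n m w w' p q
  proof (cases m)
    case 0
    then have "q \<in> A" using q by simp
    moreover have "q = y'"
      using q \<open>q \<in> A\<close> y y' by (metis A_carr inv_unique m_comm)
    ultimately show False using y' by simp
  next
    case (Suc m')
    then obtain n' where n: "n = Suc n'" "m' \<le> n'" using le by (cases n) auto
    obtain h b where hb: "h \<in> poly_values R A w' m'" "b \<in> A" "q = h \<otimes> w' \<oplus> b"
      using poly_values_SucE q(1) Suc by metis
    obtain g a where ga: "g \<in> poly_values R A w n'" "a \<in> A" "p = g \<oplus> a \<otimes> w [^] Suc n'"
      using poly_values_leading[OF A w(1)] p(1) n by metis
    have c: "h \<in> carrier R" "b \<in> carrier R" "y \<in> carrier R" "g \<in> carrier R" "a \<in> carrier R"
      "w [^] n' \<in> carrier R"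
      using hb ga y poly_values_closed[OF A w(1)] poly_values_closed[OF A w(2)] w by auto
    \<comment> \<open>Multiplying \<open>y q = 1\<close> by \<open>w\<close> gives
      \<open>d w = y h\<close>. As \<open>d\<close> turns out to be a unit of \<open>A\<close> with
      inverse \<open>e\<close>, this reads \<open>w = e y h\<close>. Multiplied by
      \<open>w [^] n'\<close>, it expresses the leading power of \<open>w\<close> in
      \<open>p\<close> with degree at most \<open>n'\<close>.\<close>
    define d where "d = \<one> \<ominus> y \<otimes> b"
    have dc: "d \<in> carrier R" using c by (simp add: d_def)
    have "d = y \<otimes> q \<ominus> y \<otimes> b" using q by (simp add: d_def)
    also have "\<dots> = y \<otimes> h \<otimes> w'" unfolding hb(3) using c w by algebra
    finally have "d \<otimes> w = (y \<otimes> h) \<otimes> (w \<otimes> w')"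
      using c(1-3) w(1,2) by algebra
    then have dw: "d \<otimes> w = y \<otimes> h" using c w by simp
    have "d \<noteq> \<zero>"
    proof
      assume "d = \<zero>"
      moreover have "\<one> = d \<oplus> y \<otimes> b" using c(2,3) unfolding d_def by algebra
      ultimately have "y \<otimes> b = \<one>" using c by simp
      then have "b = y'" using c y' by (metis inv_unique m_comm)
      then show False using hb(2) y' by simp
    qed
    then have "d \<in> Units R" using dc field_Units by simp
    then obtain e where e: "e \<in> carrier R" "d \<otimes> e = \<one>" by (auto simp: Units_def)
    then have eA: "e \<in> A" using one_minus_unit[OF hb(2)] by (simp add: d_def)
    have "w = (d \<otimes> e) \<otimes> w" by (simp only: e(2) l_one[OF w(1)])
    also have "\<dots> = e \<otimes> (d \<otimes> w)" using e(1) w(1) dc by algebra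
    finally have w_eq: "w = (e \<otimes> y) \<otimes> h" using dw e c by (simp add: m_assoc)
    define t where "t = w [^] n'"
    have "t \<otimes> w = (e \<otimes> y) \<otimes> (t \<otimes> h)"
      using e c unfolding t_def by (subst w_eq) (simp add: m_ac w)
    moreover have "t \<otimes> h \<in> poly_values R A w n'"
      using poly_values_inverse[OF A w hb(1) n(2)] by (simp add: t_def)
    ultimately have "w [^] Suc n' \<in> poly_values R A w n'"
      using poly_values_smult[OF A w(1)] eA y by (simp add: A_simps t_def)
    then have "p \<in> poly_values R A w n'"
      unfolding ga using poly_values_add[OF A w(1) ga(1)] poly_values_smult[OF A w(1) ga(2)] by simp
    then show False using IH[of n' p] p(2) n by simp
  qed
  show False
  proof (cases "m \<le> n")
    case True
    show False
    proof (rule step[OF less.prems(1-7) _ True])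
      fix n' p' assume "n' < n" "p' \<in> poly_values R A w n'" "y \<otimes> p' = \<one>"
      then show False using less.hyps[OF _ less.prems(1-3) _ _ less.prems(6,7)] by simp
    qed
  next
    case False
    have *: "w' \<otimes> w = \<one>" using less.prems m_comm by simp
    show False
    proof (rule step[OF less.prems(2,1) * less.prems(6,7,4,5)])
      fix m' q' assume "m' < m" "q' \<in> poly_values R A w' m'" "y \<otimes> q' = \<one>"
      then show False using less.hyps[OF _ less.prems(1-5)] by simp
    qed (use False in simp)
  qed
qed

text \<open>Otherwise both \<open>A[w]\<close> and \<open>A[1/w]\<close> would be proper
  enlargements of \<open>A\<close> and contain \<open>1/y\<close>, which gives two expansions of
  \<open>1/y\<close> that cannot coexist.\<close>

lemma valuation_ring:
  assumes w: "w \<in> carrier R" "w' \<in> carrier R" "w \<otimes> w' = \<one>"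
  shows "w \<in> A \<or> w' \<in> A"
proof (rule ccontr)
  assume "\<not> (w \<in> A \<or> w' \<in> A)"
  then have "y' \<in> simple_extension A w" "y' \<in> simple_extension A w'"
    using extension_cases w by blast+
  then obtain n m where "y' \<in> poly_values R A w n" "y' \<in> poly_values R A w' m"
    using simple_extension_poly_values[OF A] w by metis
  then show False using no_two_expansions[OF w] y' by blast
qed

end

section \<open>Rank one valuation rings from discrete valuation rings\<close>

text \<open>For nonzero \<open>y\<close> in a field: \<open>B\<close> is a discrete valuation ring
  with uniformizer \<open>y\<close>. Units of \<open>B\<close> are given by an explicit inverse in
  \<open>B\<close>, because \<open>Units R\<close> would refer to the ambient ring.\<close>

definition (in ring) dvr :: "'a set \<Rightarrow> 'a \<Rightarrow> bool" where
  "dvr B y \<longleftrightarrow> subring B R \<and> y \<in> B \<and> (\<forall>c\<in>B. y \<otimes> c \<noteq> \<one>) \<and>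
    (\<forall>b\<in>B. b \<noteq> \<zero> \<longrightarrow> (\<exists>k::nat. \<exists>u\<in>B. \<exists>v\<in>B. u \<otimes> v = \<one> \<and> b = y [^] k \<otimes> u))"

text \<open>
  For \<open>x \<noteq> \<zero>\<close> in a domain this is transcendence of \<open>x\<close> over \<open>B\<close>: dividing a polynomial relation
  by a power of \<open>x\<close> makes its constant term nonzero.
\<close>

definition (in ring) free_over :: "'a set \<Rightarrow> 'a \<Rightarrow> bool" where
  "free_over B x \<longleftrightarrow> (\<forall>h\<in>simple_extension B x. \<forall>b\<in>B. h \<otimes> x \<oplus> b = \<zero> \<longrightarrow> b = \<zero>)"

context ring
begin

lemma dvrD:
  assumes "dvr B y"
  shows "subring B R" "y \<in> B" "c \<in> B \<Longrightarrow> y \<otimes> c \<noteq> \<one>"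
  using assms by (auto simp: dvr_def)

lemma dvrE:
  assumes "dvr B y" "b \<in> B" "b \<noteq> \<zero>"
  obtains k :: nat and u v where "u \<in> B" "v \<in> B" "u \<otimes> v = \<one>" "b = y [^] k \<otimes> u"
  using assms by (auto simp: dvr_def)

lemma simple_extensionE:
  assumes "subring B R" "x \<in> carrier R" "f \<in> simple_extension B x"
  obtains h b where "h \<in> simple_extension B x" "b \<in> B" "f = h \<otimes> x \<oplus> b"
proof -
  from assms(3) show thesis
  proof (cases rule: simple_extension.cases)
    case zero
    then have "f = \<zero> \<otimes> x \<oplus> \<zero>" using assms(2) by simp
    then show thesis using that subringE(2)[OF assms(1)] simple_extension.zero by blast
  next
    case (lin k1 k2)
    then show thesis using that by blast
  qed
qed

text \<open>Zorn's lemma applies because the uniformizer stays the same along a chain: a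
  factorization \<open>y [^] k \<otimes> u\<close> found in one member is still one in the
  union.\<close>

lemma dvr_maximal:
  assumes "dvr B\<^sub>0 y"
  obtains B where "dvr B y" "B\<^sub>0 \<subseteq> B" "\<And>B'. \<lbrakk>dvr B' y; B \<subseteq> B'\<rbrakk> \<Longrightarrow> B' = B"
proof -
  define F where "F = {B. dvr B y \<and> B\<^sub>0 \<subseteq> B}"
  have "\<exists>M\<in>F. \<forall>Z\<in>F. M \<subseteq> Z \<longrightarrow> Z = M"
  proof (rule subset_Zorn_nonempty)
    show "F \<noteq> {}" using assms by (auto simp: F_def)
    fix \<C> assume C: "\<C> \<noteq> {}" "subset.chain F \<C>"
    then have sub: "subring (\<Union>\<C>) R" by (rule subring_Union_chain) (simp add: F_def dvr_def)
    have F: "dvr B y" "B\<^sub>0 \<subseteq> B" if "B \<in> \<C>" for B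
      using that C(2) by (auto simp: pred_on.chain_def F_def)
    have "\<exists>k::nat. \<exists>u\<in>\<Union>\<C>. \<exists>v\<in>\<Union>\<C>. u \<otimes> v = \<one> \<and> b = y [^] k \<otimes> u"
      if b: "b \<in> \<Union>\<C>" "b \<noteq> \<zero>" for b
    proof -
      obtain B where B: "B \<in> \<C>" "b \<in> B" using b by blast
      obtain k :: nat and u v where "u \<in> B" "v \<in> B" "u \<otimes> v = \<one>" "b = y [^] k \<otimes> u"
        using dvrE[OF F(1)[OF B(1)] B(2) b(2)] .
      then show ?thesis using B(1) by blast
    qed
    then have "dvr (\<Union>\<C>) y"
      using sub C(1) dvrD(2,3)[OF F(1)] unfolding dvr_def by (metis UnionE UnionI ex_in_conv)
    then show "\<Union>\<C> \<in> F" using C(1) F(2) by (auto simp: F_def)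
  qed
  then show thesis using that by (auto simp: F_def)
qed

end

context field
begin

lemma field_inverse:
  assumes "x \<in> carrier R" "x \<noteq> \<zero>"
  obtains x' where "x' \<in> carrier R" "x' \<noteq> \<zero>" "x \<otimes> x' = \<one>"
proof -
  have u: "x \<in> Units R" using assms field_Units by simp
  then have "x \<otimes> inv x = \<one>" "inv x \<in> carrier R" by simp_all
  moreover have "inv x \<noteq> \<zero>"
    using Units_inv_Units[OF u] field_Units by simp
  ultimately show thesis using that by blast
qed

text \<open>The ring sought is the localization of \<open>C\<close> at the prime ideal
  \<open>N = y C\<close>. Elements outside \<open>N\<close> become units, so \<open>factor\<close>
  gives the factorization required by \<open>dvr\<close>. All discrete valuation rings below arise
  in this way: from the integers at a prime, from \<open>B[x]\<close> at \<open>x\<close>, and as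
  Gauss extensions.\<close>

lemma dvr_localization:
  assumes C: "subring C R" and y: "y \<in> C"
    and nonunit: "\<And>c. c \<in> C \<Longrightarrow> y \<otimes> c \<noteq> \<one>"
    and N: "N = (\<otimes>) y ` C"
    and prime: "\<And>f g. \<lbrakk>f \<in> C; g \<in> C; f \<otimes> g \<in> N\<rbrakk> \<Longrightarrow> f \<in> N \<or> g \<in> N"
    and factor: "\<And>f. \<lbrakk>f \<in> C; f \<noteq> \<zero>\<rbrakk> \<Longrightarrow> \<exists>k::nat. \<exists>g\<in>C - N. f = y [^] k \<otimes> g"
  obtains B where "dvr B y" "C \<subseteq> B"
proof -
  define B where "B = {b \<in> carrier R. \<exists>g\<in>C - N. b \<otimes> g \<in> C}"
  note Cs = subringE(2-3,5-7)[OF C]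
  have Cc [simp]: "c \<in> carrier R" if "c \<in> C" for c using subringE(1)[OF C] that by blast
  have one: "\<one> \<in> C - N" using nonunit Cs by (force simp: N)
  have "\<zero> = y \<otimes> \<zero>" using y by simp
  then have zero: "\<zero> \<in> N" unfolding N using Cs(1) by blast
  have mult: "f \<otimes> g \<in> C - N" if "f \<in> C - N" "g \<in> C - N" for f g
    using that prime Cs by blast
  have CB: "C \<subseteq> B" unfolding B_def using one by (auto intro!: bexI[of _ \<one>])
  have "subring B R"
  proof (rule subringI)
    show "B \<subseteq> carrier R" by (auto simp: B_def)
    show "\<one> \<in> B" using CB one by blast
    show "\<ominus> b \<in> B" if "b \<in> B" for b
    proof -
      obtain g where g: "b \<in> carrier R" "g \<in> C - N" "b \<otimes> g \<in> C" using \<open>b \<in> B\<close> by (auto simp: B_def)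
      then have "\<ominus> b \<otimes> g \<in> C" using Cs(3)[OF g(3)] by (simp add: l_minus)
      then show ?thesis using g unfolding B_def by auto
    qed
    fix a b assume "a \<in> B" "b \<in> B"
    then obtain g h where g: "a \<in> carrier R" "g \<in> C - N" "a \<otimes> g \<in> C"
      and h: "b \<in> carrier R" "h \<in> C - N" "b \<otimes> h \<in> C" by (auto simp: B_def)
    have c: "g \<in> carrier R" "h \<in> carrier R" using g h by auto
    have "(a \<otimes> b) \<otimes> (g \<otimes> h) = (a \<otimes> g) \<otimes> (b \<otimes> h)" using g(1) h(1) c by algebra
    also have "\<dots> \<in> C" using g(3) h(3) by (rule Cs(4))
    finally show "a \<otimes> b \<in> B" using g h mult[OF g(2) h(2)] unfolding B_def by auto
    have "(a \<oplus> b) \<otimes> (g \<otimes> h) = (a \<otimes> g) \<otimes> h \<oplus> (b \<otimes> h) \<otimes> g" using g(1) h(1) c by algebra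
    also have "\<dots> \<in> C" using Cs(5)[OF Cs(4)[OF g(3)] Cs(4)[OF h(3)]] g(2) h(2) by blast
    finally show "a \<oplus> b \<in> B" using g h mult[OF g(2) h(2)] unfolding B_def by auto
  qed
  moreover have "y \<in> B" using CB y by blast
  moreover have "y \<otimes> b \<noteq> \<one>" if "b \<in> B" for b
  proof
    assume *: "y \<otimes> b = \<one>"
    obtain g where g: "b \<in> carrier R" "g \<in> C - N" "b \<otimes> g \<in> C" using \<open>b \<in> B\<close> by (auto simp: B_def)
    have "y \<otimes> (b \<otimes> g) = (y \<otimes> b) \<otimes> g" using g y by (simp add: m_assoc)
    then have "y \<otimes> (b \<otimes> g) = g" using * g by simp
    then have "g \<in> N" unfolding N using g(3) by (metis image_eqI)
    then show False using g by blast
  qed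
  \<comment> \<open>If \<open>b g = y [^] k \<otimes> h\<close>, the unit is \<open>h/g\<close> with
    inverse \<open>g/h\<close>: both \<open>g\<close> and \<open>h\<close> lie outside
    \<open>N\<close> and are admissible denominators.\<close>
  moreover have "\<exists>k::nat. \<exists>u\<in>B. \<exists>v\<in>B. u \<otimes> v = \<one> \<and> b = y [^] k \<otimes> u"
    if b: "b \<in> B" "b \<noteq> \<zero>" for b
  proof -
    obtain g where g: "b \<in> carrier R" "g \<in> C - N" "b \<otimes> g \<in> C" using b by (auto simp: B_def)
    have gc: "g \<in> carrier R" "g \<noteq> \<zero>" using g zero by auto
    obtain k :: nat and h where h: "h \<in> C - N" "b \<otimes> g = y [^] k \<otimes> h"
      using factor[OF g(3)] integral[of b g] g gc b by auto
    have hc: "h \<in> carrier R" "h \<noteq> \<zero>" using h zero by auto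
    obtain g' where g': "g' \<in> carrier R" "g \<otimes> g' = \<one>" using field_inverse[OF gc] by blast
    obtain h' where h': "h' \<in> carrier R" "h \<otimes> h' = \<one>" using field_inverse[OF hc] by blast
    have "(h \<otimes> g') \<otimes> g = h \<otimes> (g \<otimes> g')" using hc(1) gc(1) g'(1) by algebra
    then have "(h \<otimes> g') \<otimes> g \<in> C" using g' hc h by simp
    then have u: "h \<otimes> g' \<in> B" using g hc g' unfolding B_def by auto
    have "(g \<otimes> h') \<otimes> h = g \<otimes> (h \<otimes> h')" using hc(1) gc(1) h'(1) by algebra
    then have "(g \<otimes> h') \<otimes> h \<in> C" using h' gc g by simp
    then have v: "g \<otimes> h' \<in> B" using h gc h' unfolding B_def by auto
    have "(h \<otimes> g') \<otimes> (g \<otimes> h') = (g \<otimes> g') \<otimes> (h \<otimes> h')"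
      using hc(1) gc(1) g'(1) h'(1) by algebra
    then have uv: "(h \<otimes> g') \<otimes> (g \<otimes> h') = \<one>" using g' h' by simp
    have "b = b \<otimes> (g \<otimes> g')" using g g' by simp
    also have "\<dots> = (b \<otimes> g) \<otimes> g'" using g(1) gc(1) g'(1) by (simp only: m_assoc)
    also have "\<dots> = y [^] k \<otimes> (h \<otimes> g')"
      unfolding h(2) using y hc(1) g'(1) by (simp add: m_assoc)
    finally show ?thesis using u v uv by blast
  qed
  ultimately have "dvr B y" unfolding dvr_def by blast
  then show thesis using that CB by blast
qed

lemma free_overD:
  assumes "free_over B x" "subring B R" "x \<in> carrier R" "x \<noteq> \<zero>"
    and "h \<in> simple_extension B x" "b \<in> B" "h \<otimes> x \<oplus> b = \<zero>"
  shows "b = \<zero>" "h = \<zero>"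
proof -
  show b: "b = \<zero>" using assms by (auto simp: free_over_def)
  have "h \<in> carrier R"
    using simple_extension_in_carrier[OF subringE(1)[OF assms(2)] assms(3)] assms(5) by blast
  then show "h = \<zero>" using assms(3,4,7) b integral by auto
qed

text \<open>Subtracting the two expressions gives a relation to which freeness applies. This allows
  comparing coefficients in \<open>B[x]\<close> as in a polynomial ring.\<close>

lemma free_over_unique:
  assumes f: "free_over B x" and B: "subring B R" and x: "x \<in> carrier R" "x \<noteq> \<zero>"
    and h: "h \<in> simple_extension B x" "b \<in> B" and g: "g \<in> simple_extension B x" "c \<in> B"
    and eq: "h \<otimes> x \<oplus> b = g \<otimes> x \<oplus> c"
  shows "h = g" "b = c"
proof -
  have E: "subring (simple_extension B x) R" by (rule simple_extension_is_subring[OF B x(1)])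
  have c: "h \<in> carrier R" "g \<in> carrier R" "b \<in> carrier R" "c \<in> carrier R"
    using h g subringE(1)[OF E] subringE(1)[OF B] by auto
  have "(h \<ominus> g) \<otimes> x \<oplus> (b \<ominus> c) = (h \<otimes> x \<oplus> b) \<ominus> (g \<otimes> x \<oplus> c)" using c x(1) by algebra
  also have "\<dots> = \<zero>" unfolding eq using c x by (simp add: a_minus_def r_neg)
  finally have "b \<ominus> c = \<zero>" "h \<ominus> g = \<zero>"
    using free_overD[OF f B x subring_minus[OF E h(1) g(1)] subring_minus[OF B h(2) g(2)]]
    by simp_all
  then show "h = g" "b = c" using c by simp_all
qed

text \<open>The Gauss extension: \<open>C = B[x]\<close> behaves like a polynomial ring over
  \<open>B\<close>, so \<open>y\<close> generates a prime ideal of it by Gauss's lemma, and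
  localizing there keeps the uniformizer \<open>y\<close>.\<close>

lemma dvr_adjoin_free:
  assumes B: "dvr B y" and y: "y \<noteq> \<zero>" and x: "x \<in> carrier R" "x \<noteq> \<zero>" and free: "free_over B x"
  obtains B' where "dvr B' y" "B \<subseteq> B'" "x \<in> B'"
proof -
  note sB = dvrD(1)[OF B]
  define C where "C = simple_extension B x"
  have C: "subring C R" unfolding C_def by (rule simple_extension_is_subring[OF sB x(1)])
  note Bs = subringE(2-3,5-7)[OF sB] and Cs = subringE(2-3,5-7)[OF C]
  have Bc [simp]: "b \<in> carrier R" if "b \<in> B" for b using subringE(1)[OF sB] that by blast
  have Cc [simp]: "b \<in> carrier R" if "b \<in> C" for b using subringE(1)[OF C] that by blast
  have BC: "B \<subseteq> C" unfolding C_def by (rule simple_extension_incl[OF subringE(1)[OF sB] x(1)])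
  have xC: "x \<in> C" unfolding C_def by (rule simple_extension_mem[OF sB x(1)])
  have lin: "h \<otimes> x \<oplus> b \<in> C" if "h \<in> C" "b \<in> B" for h b
    using that unfolding C_def by (rule simple_extension.lin)
  have yB: "y \<in> B" and yC: "y \<in> C" using dvrD(2)[OF B] BC by auto
  have unique: "h = g \<and> b = c"
    if "h \<in> C" "b \<in> B" "g \<in> C" "c \<in> B" "h \<otimes> x \<oplus> b = g \<otimes> x \<oplus> c" for h b g c
    using free_over_unique[OF free sB x] that unfolding C_def by blast
  define N M where "N = (\<otimes>) y ` C" and "M = (\<otimes>) y ` B"
  \<comment> \<open>A polynomial is divisible by \<open>y\<close> iff all its coefficients are; this
    is the recursive form of that fact along the Horner scheme.\<close>
  have N_lin: "h \<otimes> x \<oplus> b \<in> N \<longleftrightarrow> h \<in> N \<and> b \<in> M" if h: "h \<in> C" and b: "b \<in> B" for h b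
  proof
    assume "h \<otimes> x \<oplus> b \<in> N"
    then obtain f where f: "f \<in> C" "h \<otimes> x \<oplus> b = y \<otimes> f" by (auto simp: N_def)
    then obtain g c where g: "g \<in> C" "c \<in> B" "f = g \<otimes> x \<oplus> c"
      using simple_extensionE[OF sB x(1)] unfolding C_def by metis
    have "y \<otimes> (g \<otimes> x \<oplus> c) = (y \<otimes> g) \<otimes> x \<oplus> (y \<otimes> c)"
      using g yB x by (simp add: r_distr m_assoc)
    then have "h \<otimes> x \<oplus> b = (y \<otimes> g) \<otimes> x \<oplus> (y \<otimes> c)" using f g by simp
    then have "h = y \<otimes> g \<and> b = y \<otimes> c"
      using unique[OF h b Cs(4)[OF yC g(1)] Bs(4)[OF yB g(2)]] by blast
    then show "h \<in> N \<and> b \<in> M" using g by (auto simp: N_def M_def)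
  next
    assume "h \<in> N \<and> b \<in> M"
    then obtain g c where g: "g \<in> C" "c \<in> B" "h = y \<otimes> g" "b = y \<otimes> c"
      by (auto simp: N_def M_def)
    then have "h \<otimes> x \<oplus> b = y \<otimes> (g \<otimes> x \<oplus> c)"
      using yB x by (simp add: r_distr m_assoc)
    then show "h \<otimes> x \<oplus> b \<in> N" using lin g by (simp add: N_def)
  qed
  have N_mult: "g \<otimes> h \<in> N" "h \<otimes> g \<in> N" if h: "h \<in> N" and g: "g \<in> C" for g h
  proof -
    obtain f where f: "f \<in> C" "h = y \<otimes> f" using h by (auto simp: N_def)
    have "g \<otimes> h = y \<otimes> (g \<otimes> f)" "h \<otimes> g = y \<otimes> (g \<otimes> f)" using f g yB by (auto simp: m_ac)
    then show "g \<otimes> h \<in> N" "h \<otimes> g \<in> N" using f g by (auto simp: N_def Cs)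
  qed
  have N_minus: "g \<ominus> h \<in> N" if g: "g \<in> N" and h: "h \<in> N" for g h
  proof -
    obtain e f where f: "e \<in> C" "g = y \<otimes> e" "f \<in> C" "h = y \<otimes> f" using g h by (auto simp: N_def)
    have "e \<in> carrier R" "f \<in> carrier R" "y \<in> carrier R" using f yB by auto
    then have "y \<otimes> e \<ominus> y \<otimes> f = y \<otimes> (e \<ominus> f)" by algebra
    then show ?thesis using f subring_minus[OF C f(1,3)] by (auto simp: N_def)
  qed
  have unit: "\<exists>c\<in>B. b \<otimes> c = \<one>" if b: "b \<in> B" "b \<notin> M" for b
  proof -
    have "b \<noteq> \<zero>"
    proof
      assume "b = \<zero>"
      then have "b = y \<otimes> \<zero>" using yB by simp
      then show False using b Bs(1) by (auto simp: M_def)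
    qed
    then obtain k :: nat and u v where u: "u \<in> B" "v \<in> B" "u \<otimes> v = \<one>" "b = y [^] k \<otimes> u"
      using dvrE[OF B b(1)] by metis
    show ?thesis
    proof (cases k)
      case 0
      then show ?thesis using u by auto
    next
      case (Suc n)
      then have "b = y \<otimes> (y [^] n \<otimes> u)"
        unfolding u(4) using yB u by (simp add: m_assoc m_comm m_lcomm)
      then show ?thesis using b u subring_nat_pow[OF sB yB] by (auto simp: M_def Bs)
    qed
  qed
  have prime: "f \<in> N \<or> g \<in> N" if "f \<in> C" "g \<in> C" "f \<otimes> g \<in> N" for f g
    using that(1)[unfolded C_def] that(2,3)
  proof (induction arbitrary: g rule: simple_extension.induct)
    case zero
    have "\<zero> = y \<otimes> \<zero>" using yB by simp
    then show ?case using Cs(1) by (auto simp: N_def)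
  next
    case (lin f b)
    note f = lin.hyps(1)[folded C_def] and b = lin.hyps(2)
    show ?case
    proof (cases "b \<in> M")
      case True
      then have bN: "b \<in> N" using BC by (auto simp: N_def M_def)
      have c: "f \<in> carrier R" "g \<in> carrier R" "b \<in> carrier R" using f b lin.prems by auto
      have "(f \<otimes> x \<oplus> b) \<otimes> g \<ominus> b \<otimes> g = (f \<otimes> g) \<otimes> x \<oplus> \<zero>" using c x(1) by algebra
      then have "(f \<otimes> g) \<otimes> x \<oplus> \<zero> \<in> N"
        using N_minus[OF lin.prems(2) N_mult(2)[OF bN lin.prems(1)]] by simp
      then have "f \<otimes> g \<in> N" using N_lin Cs Bs f lin.prems by simp
      then have "f \<in> N \<or> g \<in> N" using lin.IH lin.prems by blast
      then show ?thesis using N_lin[OF f b] True by blast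
    next
      case False
      then obtain b' where b': "b' \<in> B" "b \<otimes> b' = \<one>" using unit[OF b] by blast
      have "g \<in> N"
        using lin.prems(1)[unfolded C_def] lin.prems(2)
      proof (induction rule: simple_extension.induct)
        case zero
        have "\<zero> = y \<otimes> \<zero>" using yB by simp
        then show ?case using Cs(1) by (auto simp: N_def)
      next
        case (lin g d)
        note g = lin.hyps(1)[folded C_def] and d = lin.hyps(2)
        have c: "f \<in> carrier R" "g \<in> carrier R" "b \<in> carrier R" "d \<in> carrier R" "b' \<in> carrier R"
          "y \<in> carrier R"
          using f g b d b' yB by auto
        have "(f \<otimes> x \<oplus> b) \<otimes> (g \<otimes> x \<oplus> d) = (f \<otimes> (g \<otimes> x \<oplus> d) \<oplus> b \<otimes> g) \<otimes> x \<oplus> b \<otimes> d"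
          using c x(1) by algebra
        moreover have "f \<otimes> (g \<otimes> x \<oplus> d) \<oplus> b \<otimes> g \<in> C"
          using f g b d BC xC by (intro Cs) auto
        ultimately have "b \<otimes> d \<in> M" using N_lin lin.prems b d Bs by simp
        then obtain e where e: "e \<in> B" "b \<otimes> d = y \<otimes> e" by (auto simp: M_def)
        have "d = (b \<otimes> b') \<otimes> d" using b'(2) c by simp
        also have "\<dots> = b' \<otimes> (b \<otimes> d)" using c(3-5) by algebra
        also have "\<dots> = y \<otimes> (b' \<otimes> e)" unfolding e using c(5,6) Bc[OF e(1)] by algebra
        finally have dM: "d \<in> M" using e b' by (auto simp: M_def Bs)
        then have dN: "d \<in> N" using BC by (auto simp: N_def M_def)
        have fb: "f \<otimes> x \<oplus> b \<in> C" using f b by (rule \<open>\<And>h b. \<lbrakk>h \<in> C; b \<in> B\<rbrakk> \<Longrightarrow> h \<otimes> x \<oplus> b \<in> C\<close>)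
        have "(f \<otimes> x \<oplus> b) \<otimes> (g \<otimes> x \<oplus> d) \<ominus> (f \<otimes> x \<oplus> b) \<otimes> d = ((f \<otimes> x \<oplus> b) \<otimes> g) \<otimes> x \<oplus> \<zero>"
          using c x(1) by algebra
        then have "((f \<otimes> x \<oplus> b) \<otimes> g) \<otimes> x \<oplus> \<zero> \<in> N"
          using N_minus[OF lin.prems N_mult(1)[OF dN fb]] by simp
        then have "(f \<otimes> x \<oplus> b) \<otimes> g \<in> N" using N_lin Cs(4)[OF fb g] Bs by simp
        then have "g \<in> N" using lin.IH by blast
        then show ?case using N_lin[OF g d] dM by blast
      qed
      then show ?thesis by blast
    qed
  qed
  \<comment> \<open>The exponent is the smallest one among the nonzero coefficients. After taking it
    out, some coefficient is a unit of \<open>B\<close>, so the cofactor is not in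
    \<open>N\<close>.\<close>
  have factor: "\<exists>k::nat. \<exists>g\<in>C - N. f = y [^] k \<otimes> g" if "f \<in> C" "f \<noteq> \<zero>" for f
    using that(1)[unfolded C_def] that(2)
  proof (induction rule: simple_extension.induct)
    case zero
    then show ?case by simp
  next
    case (lin f b)
    note f = lin.hyps(1)[folded C_def] and b = lin.hyps(2)
    have uM: "u \<notin> M" if "u \<in> B" "v \<in> B" "u \<otimes> v = \<one>" for u v
    proof
      assume "u \<in> M"
      then obtain e where e: "e \<in> B" "u = y \<otimes> e" by (auto simp: M_def)
      have "y \<otimes> (e \<otimes> v) = \<one>" using e that yB by (simp add: m_assoc)
      then show False using dvrD(3)[OF B] Bs(4)[OF e(1) that(2)] by blast
    qed
    consider "f = \<zero>" "b \<noteq> \<zero>" | "f \<noteq> \<zero>" "b = \<zero>" | "f \<noteq> \<zero>" "b \<noteq> \<zero>"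
      using lin.prems f b x by fastforce
    then show ?case
    proof cases
      case 1
      obtain k :: nat and u v where u: "u \<in> B" "v \<in> B" "u \<otimes> v = \<one>" "b = y [^] k \<otimes> u"
        using dvrE[OF B b 1(2)] by metis
      have "\<zero> \<otimes> x \<oplus> u \<notin> N" using N_lin[OF Cs(1) u(1)] uM[OF u(1-3)] by blast
      then have "u \<in> C - N" using u BC x by auto
      moreover have "f \<otimes> x \<oplus> b = y [^] k \<otimes> u" using 1 u yB x by simp
      ultimately show ?thesis by blast
    next
      case 2
      then obtain k :: nat and g where g: "g \<in> C - N" "f = y [^] k \<otimes> g" using lin.IH by blast
      have "g \<otimes> x \<oplus> \<zero> \<notin> N" using N_lin[of g \<zero>] g Bs by simp
      then have "g \<otimes> x \<in> C - N" using g xC x by (auto simp: Cs)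
      moreover have "f \<otimes> x \<oplus> b = y [^] k \<otimes> (g \<otimes> x)" using 2 g yB x by (simp add: m_assoc)
      ultimately show ?thesis by blast
    next
      case 3
      obtain k :: nat and u v where u: "u \<in> B" "v \<in> B" "u \<otimes> v = \<one>" "b = y [^] k \<otimes> u"
        using dvrE[OF B b 3(2)] by metis
      obtain i :: nat and g where g: "g \<in> C - N" "f = y [^] i \<otimes> g" using lin.IH 3 by blast
      show ?thesis
      proof (cases "k \<le> i")
        case True
        have p: "y [^] i = y [^] k \<otimes> y [^] (i - k)" using nat_pow_mult[of y k "i - k"] True yB by simp
        have gC: "y [^] (i - k) \<otimes> g \<in> C" using g subring_nat_pow[OF C yC] by (simp add: Cs)
        have "f \<otimes> x \<oplus> b = y [^] k \<otimes> ((y [^] (i - k) \<otimes> g) \<otimes> x \<oplus> u)"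
          unfolding g u p using g u yB x by (simp add: r_distr m_assoc)
        moreover have "(y [^] (i - k) \<otimes> g) \<otimes> x \<oplus> u \<in> C - N"
          using N_lin[OF gC u(1)] uM[OF u(1-3)] gC u(1)
            \<open>\<And>h b. \<lbrakk>h \<in> C; b \<in> B\<rbrakk> \<Longrightarrow> h \<otimes> x \<oplus> b \<in> C\<close> by blast
        ultimately show ?thesis by blast
      next
        case False
        have p: "y [^] k = y [^] i \<otimes> y [^] (k - i)" using nat_pow_mult[of y i "k - i"] False yB by simp
        have uB: "y [^] (k - i) \<otimes> u \<in> B" using u subring_nat_pow[OF sB yB] by (simp add: Bs)
        have "f \<otimes> x \<oplus> b = y [^] i \<otimes> (g \<otimes> x \<oplus> y [^] (k - i) \<otimes> u)"
          unfolding g u p using g u yB x by (simp add: r_distr m_assoc)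
        moreover have "g \<otimes> x \<oplus> y [^] (k - i) \<otimes> u \<in> C - N"
          using N_lin[OF _ uB] uB g
            \<open>\<And>h b. \<lbrakk>h \<in> C; b \<in> B\<rbrakk> \<Longrightarrow> h \<otimes> x \<oplus> b \<in> C\<close> by blast
        ultimately show ?thesis by blast
      qed
    qed
  qed
  have nonunit: "y \<otimes> c \<noteq> \<one>" if "c \<in> C" for c
  proof
    assume "y \<otimes> c = \<one>"
    then have "\<one> \<in> N" using that unfolding N_def by (metis imageI)
    then have "\<zero> \<otimes> x \<oplus> \<one> \<in> N" using x by simp
    then have "\<one> \<in> M" using N_lin Cs Bs by blast
    then obtain e where "e \<in> B" "\<one> = y \<otimes> e" by (auto simp: M_def)
    then show False using dvrD(3)[OF B] by metis
  qed
  obtain B' where "dvr B' y" "C \<subseteq> B'"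
    using dvr_localization[OF C yC nonunit N_def prime factor] by blast
  then show thesis using that BC xC by blast
qed

text \<open>If \<open>x\<close> were free over \<open>B\<close>, the Gauss extension and maximality
  would force \<open>x\<close> into \<open>B\<close>. But an element of \<open>B\<close> satisfies
  the relation with leading coefficient 1 and constant term \<open>-x\<close>, so it is not
  free.\<close>

lemma dvr_maximal_algebraic:
  assumes B: "dvr B y" and y: "y \<noteq> \<zero>" and max: "\<And>B'. \<lbrakk>dvr B' y; B \<subseteq> B'\<rbrakk> \<Longrightarrow> B' = B"
    and x: "x \<in> carrier R" "x \<noteq> \<zero>"
  obtains h b where "h \<in> simple_extension B x" "b \<in> B" "b \<noteq> \<zero>" "h \<otimes> x \<oplus> b = \<zero>"
proof -
  note sB = dvrD(1)[OF B]
  have "\<not> free_over B x"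
  proof
    assume f: "free_over B x"
    then obtain B' where "dvr B' y" "B \<subseteq> B'" "x \<in> B'" using dvr_adjoin_free[OF B y x] by blast
    then have "x \<in> B" using max by blast
    then have "\<ominus> x \<in> B" "\<one> \<in> simple_extension B x"
      using sB x simple_extension_incl[OF subringE(1)[OF sB] x(1)] subringE(3,5)[OF sB] by auto
    moreover have "\<one> \<otimes> x \<oplus> \<ominus> x = \<zero>" using x by (simp add: r_neg)
    ultimately have "\<ominus> x = \<zero>" using free_overD(1)[OF f sB x] by blast
    then show False using x by (metis minus_minus minus_zero)
  qed
  then show thesis using that by (auto simp: free_over_def)
qed

text \<open>
  The overring obtained here is a valuation ring of rank one: enlarging the given discrete
  valuation ring by Gauss extensions first makes the whole field algebraic over it.
\<close>

lemma dvr_archimedean_overring: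
  assumes B\<^sub>0: "dvr B\<^sub>0 y" and y': "y' \<in> carrier R" "y \<otimes> y' = \<one>"
  obtains A where "subring A R" "y \<in> A" "y' \<notin> A"
    "\<And>w. w \<in> carrier R \<Longrightarrow> \<exists>k::nat. y [^] k \<otimes> w \<in> A"
proof -
  have yc: "y \<in> carrier R"
    using dvrD(2)[OF B\<^sub>0] subringE(1)[OF dvrD(1)[OF B\<^sub>0]] by blast
  have y0: "y \<noteq> \<zero>" using y' by auto
  obtain B where B: "dvr B y" "B\<^sub>0 \<subseteq> B" "\<And>B'. \<lbrakk>dvr B' y; B \<subseteq> B'\<rbrakk> \<Longrightarrow> B' = B"
    using dvr_maximal[OF B\<^sub>0] by blast
  have "y' \<notin> B" using dvrD(3)[OF B(1)] y' by blast
  then obtain A where A: "subring A R" "B \<subseteq> A" "y' \<notin> A"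
    and max: "\<And>U. \<lbrakk>subring U R; A \<subseteq> U; y' \<notin> U\<rbrakk> \<Longrightarrow> U = A"
    using subring_maximal_avoiding[OF dvrD(1)[OF B(1)]] by metis
  have yA: "y \<in> A" using dvrD(2)[OF B(1)] A by blast
  interpret V: maximal_avoiding_inverse R A y y'
    by (intro maximal_avoiding_inverse.intro maximal_avoiding_inverse_axioms.intro
        field_axioms A yA y' max)
  have "\<exists>k::nat. y [^] k \<otimes> w \<in> A" if w: "w \<in> carrier R" for w
  proof (cases "w = \<zero>")
    case True
    then show ?thesis using yc V.A_simps by (intro exI[of _ 0]) simp
  next
    case False
    then obtain d where d: "d \<in> carrier R" "d \<noteq> \<zero>" "w \<otimes> d = \<one>" using field_inverse[OF w] by metis
    \<comment> \<open>An algebraic relation for \<open>d = 1/w\<close>. The exponent of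
      \<open>y\<close> in its constant term \<open>b\<close> is the one for which
      \<open>y [^] k \<otimes> w\<close> lies in \<open>A\<close>.\<close>
    obtain h b where h: "h \<in> simple_extension B d" "b \<in> B" "b \<noteq> \<zero>" "h \<otimes> d \<oplus> b = \<zero>"
      using dvr_maximal_algebraic[OF B(1) y0 B(3) d(1,2)] by metis
    obtain k :: nat and u v where u: "u \<in> B" "v \<in> B" "u \<otimes> v = \<one>" "b = y [^] k \<otimes> u"
      using dvrE[OF B(1) h(2,3)] by metis
    define t where "t = y [^] k"
    have t: "t \<in> carrier R" "t \<in> A" using yc subring_nat_pow[OF A(1) yA] by (simp_all add: t_def)
    have "y' [^] k \<in> carrier R" and tt: "t \<otimes> y' [^] k = \<one>"
      using y' yc by (simp_all add: t_def flip: nat_pow_distrib)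
    have t0: "t \<noteq> \<zero>" using tt \<open>y' [^] k \<in> carrier R\<close> by auto
    \<comment> \<open>\<open>e\<close> is the inverse of \<open>t w\<close>. If \<open>t w\<close>
      were outside the valuation ring \<open>A\<close>, then \<open>e\<close> would lie in
      \<open>A\<close>, and with it \<open>d = t e\<close> and \<open>h\<close>. Dividing
      \<open>h d + b = 0\<close> by \<open>t\<close> gives \<open>h e = -u\<close>, so the inverse
      of \<open>e\<close> is \<open>-h v\<close>, an element of \<open>A\<close>; but this inverse
      is \<open>t w\<close>.\<close>
    define e where "e = y' [^] k \<otimes> d"
    have ec: "e \<in> carrier R" using d y' by (simp add: e_def)
    have "t \<otimes> w \<otimes> e = (t \<otimes> y' [^] k) \<otimes> (w \<otimes> d)"
      unfolding e_def using t(1) w d(1) \<open>y' [^] k \<in> carrier R\<close> by algebra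
    then have we: "t \<otimes> w \<otimes> e = \<one>" using tt d by simp
    have "t \<otimes> w \<in> A"
    proof (rule ccontr)
      assume n: "t \<otimes> w \<notin> A"
      then have eA: "e \<in> A" using V.valuation_ring[OF _ ec we] t w by blast
      have "d = (t \<otimes> y' [^] k) \<otimes> d" using tt d by simp
      then have dte: "d = t \<otimes> e" unfolding e_def using t d \<open>y' [^] k \<in> carrier R\<close> by (simp add: m_assoc)
      then have "d \<in> A" using eA t by (simp add: V.A_simps)
      then have hA: "h \<in> A"
        using h(1) simple_extension_subring_incl[OF A(1,2)] by blast
      have uc: "u \<in> carrier R" "v \<in> carrier R" "h \<in> carrier R" and uA: "v \<in> A"
        using u A hA by auto
      have "t \<otimes> (h \<otimes> e \<oplus> u) = h \<otimes> d \<oplus> b"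
        unfolding dte u(4) t_def[symmetric] using t(1) uc ec by algebra
      then have "h \<otimes> e \<oplus> u = \<zero>"
        using h(4) integral[of t "h \<otimes> e \<oplus> u"] t uc ec t0 by simp
      then have "u = \<ominus> (h \<otimes> e)"
        using uc ec by (intro sum_zero_eq_neg) (simp_all add: a_comm)
      moreover have "(\<ominus> h \<otimes> v) \<otimes> e = \<ominus> (h \<otimes> e) \<otimes> v" using uc ec by algebra
      ultimately have ie: "(\<ominus> h \<otimes> v) \<otimes> e = \<one>" using u by simp
      have "t \<otimes> w = (t \<otimes> w) \<otimes> ((\<ominus> h \<otimes> v) \<otimes> e)" using ie t w by simp
      also have "\<dots> = (\<ominus> h \<otimes> v) \<otimes> (t \<otimes> w \<otimes> e)" using t(1) w uc ec by algebra
      also have "\<dots> = \<ominus> h \<otimes> v" using we uc by simp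
      also have "\<dots> \<in> A" using hA uA by (simp add: V.A_simps)
      finally show False using n by simp
    qed
    then show ?thesis unfolding t_def by blast
  qed
  then show thesis using that A(1,3) yA by blast
qed

end

section \<open>Prime ideals and integer multiples of one\<close>

context cring
begin

lemma ideal_adjoin:
  assumes I: "ideal I R" and a: "a \<in> carrier R"
  obtains J where "ideal J R" "I \<subseteq> J" "a \<in> J"
    "\<And>x. x \<in> J \<Longrightarrow> \<exists>i\<in>I. \<exists>r\<in>carrier R. x = i \<oplus> r \<otimes> a"
proof
  interpret I: ideal I R by fact
  show "ideal (I <+> PIdl a) R" by (intro add_ideals I cgenideal_ideal a)
  have z: "\<zero> \<in> PIdl a" using cgenideal_ideal[OF a] by (simp add: additive_subgroup.zero_closed ideal.axioms(1))
  show "I \<subseteq> I <+> PIdl a"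
  proof
    fix i assume "i \<in> I"
    moreover have "i = i \<oplus> \<zero>" using \<open>i \<in> I\<close> I.Icarr by simp
    ultimately show "i \<in> I <+> PIdl a" using z unfolding set_add_def' by blast
  qed
  have "a = \<zero> \<oplus> a" using a by simp
  then show "a \<in> I <+> PIdl a"
    using I.zero_closed cgenideal_self[OF a] unfolding set_add_def' by blast
  show "\<exists>i\<in>I. \<exists>r\<in>carrier R. x = i \<oplus> r \<otimes> a" if "x \<in> set_add R I (PIdl a)" for x
    using that by (auto simp: set_add_def' cgenideal_def)
qed

text \<open>Krull's argument: an ideal maximal among those disjoint from \<open>S\<close> is prime.
  The maximality clause is part of the conclusion because for \<open>S = {1}\<close> it makes
  \<open>P\<close> a maximal ideal.\<close>

lemma primeideal_avoiding:
  assumes I: "ideal I R" and S: "submonoid S R" and disj: "I \<inter> S = {}"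
  obtains P where "primeideal P R" "I \<subseteq> P" "P \<inter> S = {}"
    "\<And>J. \<lbrakk>ideal J R; P \<subseteq> J; J \<inter> S = {}\<rbrakk> \<Longrightarrow> J = P"
proof -
  define F where "F = {J. ideal J R \<and> I \<subseteq> J \<and> J \<inter> S = {}}"
  have "\<exists>M\<in>F. \<forall>Z\<in>F. M \<subseteq> Z \<longrightarrow> Z = M"
  proof (rule subset_Zorn_nonempty)
    show "F \<noteq> {}" using I disj by (auto simp: F_def)
    fix \<C> assume C: "\<C> \<noteq> {}" "subset.chain F \<C>"
    then have CF: "\<C> \<subseteq> F" by (simp add: pred_on.chain_def)
    have "subset.chain {I. ideal I R} \<C>" using C by (auto simp: pred_on.chain_def F_def)
    then have "ideal (\<Union>\<C>) R" using chain_Union_is_ideal[of \<C>] C(1) by simp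
    then show "\<Union>\<C> \<in> F" using C(1) CF by (auto simp: F_def)
  qed
  then obtain P where P: "ideal P R" "I \<subseteq> P" "P \<inter> S = {}"
    and max: "\<And>J. \<lbrakk>ideal J R; P \<subseteq> J; J \<inter> S = {}\<rbrakk> \<Longrightarrow> J = P"
    by (auto simp: F_def)
  interpret P: ideal P R by fact
  interpret S: submonoid S R by fact
  have meets: "\<exists>p\<in>P. \<exists>r\<in>carrier R. p \<oplus> r \<otimes> a \<in> S" if a: "a \<in> carrier R" "a \<notin> P" for a
  proof -
    obtain J where J: "ideal J R" "P \<subseteq> J" "a \<in> J"
      "\<And>x. x \<in> J \<Longrightarrow> \<exists>i\<in>P. \<exists>r\<in>carrier R. x = i \<oplus> r \<otimes> a"
      using ideal_adjoin[OF P(1) a(1)] by metis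
    then have "J \<inter> S \<noteq> {}" using max[of J] a by blast
    then show ?thesis using J(4) by fastforce
  qed
  have "primeideal P R"
  proof (rule primeidealI[OF P(1) is_cring])
    show "carrier R \<noteq> P" using P(3) S.one_closed by auto
    fix a b assume ab: "a \<in> carrier R" "b \<in> carrier R" "a \<otimes> b \<in> P"
    show "a \<in> P \<or> b \<in> P"
    proof (rule ccontr)
      assume "\<not> (a \<in> P \<or> b \<in> P)"
      then obtain p r q s where p: "p \<in> P" "r \<in> carrier R" "p \<oplus> r \<otimes> a \<in> S"
        and q: "q \<in> P" "s \<in> carrier R" "q \<oplus> s \<otimes> b \<in> S"
        using meets ab by metis
      have c: "p \<in> carrier R" "q \<in> carrier R" using p q P.Icarr by auto
      have "(p \<oplus> r \<otimes> a) \<otimes> (q \<oplus> s \<otimes> b) = p \<otimes> (q \<oplus> s \<otimes> b) \<oplus> ((r \<otimes> a) \<otimes> q \<oplus> (r \<otimes> s) \<otimes> (a \<otimes> b))"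
        using c p(2) q(2) ab(1,2) by algebra
      moreover have "p \<otimes> (q \<oplus> s \<otimes> b) \<oplus> ((r \<otimes> a) \<otimes> q \<oplus> (r \<otimes> s) \<otimes> (a \<otimes> b)) \<in> P"
        by (rule P.a_closed[OF P.I_r_closed P.a_closed[OF P.I_l_closed P.I_l_closed]])
          (use p q ab c in auto)
      ultimately show False using P(3) S.m_closed[OF p(3) q(3)] by auto
    qed
  qed
  then show thesis using that P max by blast
qed

lemma maximalideal_above:
  assumes I: "ideal I R" and one: "\<one> \<notin> I"
  obtains M where "maximalideal M R" "I \<subseteq> M"
proof -
  have "submonoid {\<one>} R" by unfold_locales auto
  then obtain P where P: "primeideal P R" "I \<subseteq> P" "P \<inter> {\<one>} = {}"
    "\<And>J. \<lbrakk>ideal J R; P \<subseteq> J; J \<inter> {\<one>} = {}\<rbrakk> \<Longrightarrow> J = P"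
    using primeideal_avoiding[OF I] one by blast
  have "maximalideal P R"
  proof (rule maximalidealI)
    show "ideal P R" using P(1) primeideal.axioms(1) by blast
    show "carrier R \<noteq> P" using P(3) by auto
    show "J = P \<or> J = carrier R" if "ideal J R" "P \<subseteq> J" for J
      using P(4)[OF that] ideal.one_imp_carrier[OF that(1)] by blast
  qed
  then show thesis using that P by blast
qed

lemma maximalideal_not_one:
  assumes "maximalideal M R"
  shows "\<one> \<notin> M"
  using maximalideal.I_notcarr[OF assms] ideal.one_imp_carrier[OF maximalideal.axioms(1)[OF assms]]
  by blast

lemma nonunit_in_maximalideal:
  assumes a: "a \<in> carrier R" "a \<notin> Units R"
  obtains M where "maximalideal M R" "a \<in> M"
proof -
  have "\<one> \<notin> PIdl a" using a by (auto simp: cgenideal_def Units_def m_comm)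
  then show thesis using maximalideal_above[OF cgenideal_ideal[OF a(1)]] cgenideal_self[OF a(1)] that
    by blast
qed

lemma maximalideal_inverse:
  assumes M: "maximalideal M R" and a: "a \<in> carrier R" "a \<notin> M"
  obtains r where "r \<in> carrier R" "\<one> \<ominus> r \<otimes> a \<in> M"
proof -
  interpret M: maximalideal M R by fact
  obtain J where J: "ideal J R" "M \<subseteq> J" "a \<in> J"
    "\<And>x. x \<in> J \<Longrightarrow> \<exists>i\<in>M. \<exists>r\<in>carrier R. x = i \<oplus> r \<otimes> a"
    using ideal_adjoin[OF M.is_ideal a(1)] by metis
  then have "J = carrier R"
    using M.I_maximal[OF J(1,2)] a additive_subgroup.a_subset[OF ideal.axioms(1)[OF J(1)]] by blast
  then obtain i r where i: "i \<in> M" "r \<in> carrier R" "\<one> = i \<oplus> r \<otimes> a" using J(4) by blast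
  have "i \<in> carrier R" using i M.Icarr by blast
  then have "(i \<oplus> r \<otimes> a) \<ominus> r \<otimes> a = i" using i(2) a(1) by algebra
  then show thesis using that[OF i(2)] i(1,3) by simp
qed

text \<open>Assumption \<open>inv\<close> makes the residue ring a field, expressed by inverses
  modulo \<open>P\<close>.\<close>

lemma primeideal_maximalI:
  assumes P: "primeideal P R"
    and inv: "\<And>a. \<lbrakk>a \<in> carrier R; a \<notin> P\<rbrakk> \<Longrightarrow> \<exists>r\<in>carrier R. \<one> \<ominus> r \<otimes> a \<in> P"
  shows "maximalideal P R"
proof (rule maximalidealI)
  show "ideal P R" using P primeideal.axioms(1) by blast
  show "carrier R \<noteq> P" using primeideal.I_notcarr[OF P] .
  fix J assume J: "ideal J R" "P \<subseteq> J" "J \<subseteq> carrier R"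
  interpret J: ideal J R by fact
  show "J = P \<or> J = carrier R"
  proof (cases "J \<subseteq> P")
    case False
    then obtain a where a: "a \<in> J" "a \<notin> P" by blast
    then obtain r where r: "r \<in> carrier R" "\<one> \<ominus> r \<otimes> a \<in> P" using inv J by blast
    have ra: "r \<otimes> a \<in> J" using a r by (simp add: J.I_l_closed)
    have "r \<otimes> a \<in> carrier R" using ra J by blast
    then have "\<one> = (\<one> \<ominus> r \<otimes> a) \<oplus> r \<otimes> a" by algebra
    also have "\<dots> \<in> J" using r ra J by (intro J.a_closed) auto
    finally show ?thesis using J.one_imp_carrier by blast
  qed (use J in blast)
qed

text \<open>If no power of \<open>a\<close> vanished, the zero ideal would be disjoint from the
  powers of \<open>a\<close>, and some prime ideal would avoid \<open>a\<close>.\<close>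

lemma in_all_primes_nilpotent:
  assumes a: "a \<in> carrier R" and all: "\<And>P. primeideal P R \<Longrightarrow> a \<in> P"
  obtains n :: nat where "a [^] n = \<zero>"
proof -
  define S where "S = range (\<lambda>n::nat. a [^] n)"
  have "submonoid S R"
  proof
    show "S \<subseteq> carrier R" using a by (auto simp: S_def)
    show "\<one> \<in> S" using nat_pow_0 unfolding S_def by (metis rangeI)
    show "x \<otimes> y \<in> S" if "x \<in> S" "y \<in> S" for x y
      using that a by (auto simp: S_def nat_pow_mult)
  qed
  moreover have "a \<in> S" using a nat_pow_eone unfolding S_def by (metis rangeI)
  ultimately have "{\<zero>} \<inter> S \<noteq> {}"
    using primeideal_avoiding[OF zeroideal] all by (metis disjoint_iff)
  then show thesis using that by (auto simp: S_def)
qed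

end

section \<open>The image of the integers in a ring\<close>

context ring
begin

abbreviation int_embed :: "int \<Rightarrow> 'a" where "int_embed n \<equiv> add_pow R n \<one>"

lemma int_embed_mult: "int_embed m \<otimes> int_embed n = int_embed (m * n)"
proof -
  have "int_embed m \<otimes> int_embed n = add_pow R m (int_embed n)"
    by (simp add: add_pow_ldistr_int)
  also have "\<dots> = int_embed (m * n)"
    using add.int_pow_pow[of \<one> m n] by (simp add: mult.commute)
  finally show ?thesis .
qed

lemma int_embed_add: "int_embed m \<oplus> int_embed n = int_embed (m + n)"
  by (simp add: add.int_pow_mult)

lemma int_embed_neg: "\<ominus> int_embed m = int_embed (- m)"
  by (simp add: add.int_pow_neg)

lemma int_embed_1: "int_embed 1 = \<one>"
  by simp

lemma int_embed_0: "int_embed 0 = \<zero>"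
  by (simp add: add_pow_def)

lemma int_embed_subring: "subring (range int_embed) R"
proof (rule subringI)
  show "\<one> \<in> range int_embed" using int_embed_1 by (metis rangeI)
qed (auto simp: int_embed_mult int_embed_add int_embed_neg)

lemma int_embed_coprime:
  assumes "coprime m n"
  obtains a b where "int_embed a \<otimes> int_embed m \<oplus> int_embed b \<otimes> int_embed n = \<one>"
proof -
  obtain a b where "a * m + b * n = 1" using bezout_int[of m n] assms by (auto simp: coprime_iff_gcd_eq_1)
  then show thesis using that[of a b] by (simp add: int_embed_mult int_embed_add)
qed

end

lemma ring_hom_int_embed:
  assumes "h \<in> ring_hom R S" "ring R" "ring S"
  shows "h (ring.int_embed R n) = ring.int_embed S n"
proof -
  interpret h: ring_hom_ring R S h using assms by (intro ring_hom_ringI2)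
  show ?thesis
    using group_hom.hom_int_pow[OF h.a_group_hom, of "\<one>\<^bsub>R\<^esub>" n]
    by (simp add: add_pow_def)
qed

section \<open>Maximal subrings from discrete valuation rings\<close>

text \<open>Let \<open>A\<close> be the archimedean overring of \<open>B\<close> in
  \<open>K\<close>. Its preimage \<open>A'\<close> does not contain \<open>z\<close>, but
  \<open>A'\<close> and \<open>z\<close> generate \<open>T\<close>: for any \<open>t\<close>, some
  \<open>p^k t\<close> lies in \<open>A'\<close>, and multiplying by \<open>z^k\<close> recovers
  \<open>t\<close> modulo the kernel of \<open>h\<close>. So a subring containing \<open>A'\<close>
  and maximal without \<open>z\<close> is a maximal subring.\<close>

lemma submaximal_of_dvr:
  assumes T: "cring T" and K: "field K" and h: "h \<in> ring_hom T K"
    and p: "p \<in> carrier T" and z: "z \<in> carrier T" and pz: "h p \<otimes>\<^bsub>K\<^esub> h z = \<one>\<^bsub>K\<^esub>"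
    and B: "ring.dvr K B (h p)"
  shows "submaximal T"
proof -
  interpret T: cring T by fact
  interpret K: field K by fact
  interpret h: ring_hom_cring T K h using h by unfold_locales
  have hz: "h z \<in> carrier K" and hp: "h p \<in> carrier K" using z p by auto
  obtain A where A: "subring A K" "h p \<in> A" "h z \<notin> A"
    and arch: "\<And>w. w \<in> carrier K \<Longrightarrow> \<exists>k::nat. h p [^]\<^bsub>K\<^esub> k \<otimes>\<^bsub>K\<^esub> w \<in> A"
    using K.dvr_archimedean_overring[OF B hz pz] by metis
  note As = subringE(2-3,5-7)[OF A(1)]
  define A' where "A' = {t \<in> carrier T. h t \<in> A}"
  have "subring A' T"
    by (rule T.subringI) (auto simp: A'_def As)
  moreover have "z \<notin> A'" using A by (simp add: A'_def)
  ultimately obtain V where V: "subring V T" "A' \<subseteq> V" "z \<notin> V"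
    and max: "\<And>U. \<lbrakk>subring U T; V \<subseteq> U; z \<notin> U\<rbrakk> \<Longrightarrow> U = V"
    using T.subring_maximal_avoiding by metis
  have full: "carrier T \<subseteq> U" if U: "subring U T" "V \<subseteq> U" "z \<in> U" for U
  proof
    fix t assume t: "t \<in> carrier T"
    obtain k :: nat where k: "h p [^]\<^bsub>K\<^esub> k \<otimes>\<^bsub>K\<^esub> h t \<in> A" using arch t by blast
    define a b where "a = p [^]\<^bsub>T\<^esub> k \<otimes>\<^bsub>T\<^esub> t" and "b = z [^]\<^bsub>T\<^esub> k"
    have c: "a \<in> carrier T" "b \<in> carrier T" using t p z by (simp_all add: a_def b_def)
    have ha: "h a = h p [^]\<^bsub>K\<^esub> k \<otimes>\<^bsub>K\<^esub> h t" and hb: "h b = h z [^]\<^bsub>K\<^esub> k"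
      using t p z by (simp_all add: a_def b_def h.ring.hom_nat_pow)
    have aU: "a \<in> U" using c k ha V(2) U(2) by (auto simp: A'_def)
    have bU: "b \<in> U" unfolding b_def by (rule T.subring_nat_pow[OF U(1,3)])
    have "h p [^]\<^bsub>K\<^esub> k \<otimes>\<^bsub>K\<^esub> h z [^]\<^bsub>K\<^esub> k = \<one>\<^bsub>K\<^esub>"
      using hp hz pz by (simp flip: K.nat_pow_distrib)
    moreover have "h a \<otimes>\<^bsub>K\<^esub> h b = (h p [^]\<^bsub>K\<^esub> k \<otimes>\<^bsub>K\<^esub> h z [^]\<^bsub>K\<^esub> k) \<otimes>\<^bsub>K\<^esub> h t"
      unfolding ha hb using hp hz t by (simp add: K.m_ac)
    ultimately have hab: "h a \<otimes>\<^bsub>K\<^esub> h b = h t" using t by simp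
    \<comment> \<open>\<open>p\<close> and \<open>z\<close> are inverse to each other only in
      \<open>K\<close>, so \<open>t\<close> and \<open>a b\<close> agree only up to the kernel of
      \<open>h\<close>, which is contained in \<open>A'\<close>.\<close>
    have "h (t \<oplus>\<^bsub>T\<^esub> \<ominus>\<^bsub>T\<^esub> (a \<otimes>\<^bsub>T\<^esub> b)) = \<zero>\<^bsub>K\<^esub>" using hab t c by (simp add: K.r_neg)
    then have "t \<oplus>\<^bsub>T\<^esub> \<ominus>\<^bsub>T\<^esub> (a \<otimes>\<^bsub>T\<^esub> b) \<in> A'"
      using As(1) t c by (simp add: A'_def del: h.hom_add)
    then have "t \<oplus>\<^bsub>T\<^esub> \<ominus>\<^bsub>T\<^esub> (a \<otimes>\<^bsub>T\<^esub> b) \<in> U" using V(2) U(2) by blast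
    moreover have "t = (t \<oplus>\<^bsub>T\<^esub> \<ominus>\<^bsub>T\<^esub> (a \<otimes>\<^bsub>T\<^esub> b)) \<oplus>\<^bsub>T\<^esub> a \<otimes>\<^bsub>T\<^esub> b"
      using t c by (simp add: T.a_assoc T.l_neg)
    ultimately show "t \<in> U" using subringE(6,7)[OF U(1)] aU bU by metis
  qed
  have "maximal_subring V T"
    unfolding maximal_subring_def
  proof (intro conjI notI)
    show "subring V T" by (fact V(1))
    show "V \<subset> carrier T" using subringE(1)[OF V(1)] z V(3) by blast
    assume "\<exists>U. subring U T \<and> V \<subset> U \<and> U \<subset> carrier T"
    then obtain U where U: "subring U T" "V \<subset> U" "U \<subset> carrier T" by blast
    then have "z \<in> U" using max by blast
    then show False using full[OF U(1)] U by blast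
  qed
  then show ?thesis by (auto simp: submaximal_def)
qed

section \<open>Discrete valuation rings at a transcendental element and at a prime number\<close>

context field
begin

text \<open>As \<open>x\<close> is transcendental over the domain \<open>B\<close>, it generates a
  prime ideal of \<open>B[x]\<close>, consisting of the elements with constant term zero. The
  localization there is the valuation ring of the order of vanishing at
  \<open>x = 0\<close>.\<close>

lemma dvr_of_free:
  assumes B: "subring B R" and x: "x \<in> carrier R" "x \<noteq> \<zero>" and free: "free_over B x"
  obtains V where "dvr V x"
proof -
  define C where "C = simple_extension B x"
  have C: "subring C R" unfolding C_def by (rule simple_extension_is_subring[OF B x(1)])
  note Bs = subringE(2-3,5-7)[OF B] and Cs = subringE(2-3,5-7)[OF C]
  have Bc [simp]: "b \<in> carrier R" if "b \<in> B" for b using subringE(1)[OF B] that by blast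
  have Cc [simp]: "b \<in> carrier R" if "b \<in> C" for b using subringE(1)[OF C] that by blast
  have BC: "B \<subseteq> C" unfolding C_def by (rule simple_extension_incl[OF subringE(1)[OF B] x(1)])
  have xC: "x \<in> C" unfolding C_def by (rule simple_extension_mem[OF B x(1)])
  have CE: thesis' if "f \<in> C" "\<And>h b. \<lbrakk>h \<in> C; b \<in> B; f = h \<otimes> x \<oplus> b\<rbrakk> \<Longrightarrow> thesis'" for f thesis'
    using simple_extensionE[OF B x(1)] that unfolding C_def by metis
  define N where "N = (\<otimes>) x ` C"
  have N_iff: "h \<otimes> x \<oplus> b \<in> N \<longleftrightarrow> b = \<zero>" if h: "h \<in> C" and b: "b \<in> B" for h b
  proof
    assume "h \<otimes> x \<oplus> b \<in> N"
    then obtain f where f: "f \<in> C" "h \<otimes> x \<oplus> b = x \<otimes> f" by (auto simp: N_def)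
    then have "h \<otimes> x \<oplus> b = f \<otimes> x \<oplus> \<zero>" using x by (simp add: m_comm)
    then show "b = \<zero>"
      using free_over_unique(2)[OF free B x] h b f Bs(1) unfolding C_def by blast
  next
    assume "b = \<zero>"
    then have "h \<otimes> x \<oplus> b = x \<otimes> h" using h x by (simp add: m_comm)
    then show "h \<otimes> x \<oplus> b \<in> N" using h by (simp add: N_def)
  qed
  have nonunit: "x \<otimes> c \<noteq> \<one>" if c: "c \<in> C" for c
  proof
    assume *: "x \<otimes> c = \<one>"
    have "\<one> \<in> N" using c unfolding N_def *[symmetric] by blast
    then have "\<zero> \<otimes> x \<oplus> \<one> \<in> N" using x by simp
    then show False using N_iff[OF Cs(1) Bs(2)] by simp
  qed
  have prime: "f \<in> N \<or> g \<in> N" if f: "f \<in> C" and g: "g \<in> C" and fg: "f \<otimes> g \<in> N" for f g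
  proof -
    obtain f' b where f': "f' \<in> C" "b \<in> B" "f = f' \<otimes> x \<oplus> b" using CE[OF f] by blast
    obtain g' c where g': "g' \<in> C" "c \<in> B" "g = g' \<otimes> x \<oplus> c" using CE[OF g] by blast
    have c: "f' \<in> carrier R" "g' \<in> carrier R" "b \<in> carrier R" "c \<in> carrier R" using f' g' by auto
    have "f \<otimes> g = (f' \<otimes> (g' \<otimes> x \<oplus> c) \<oplus> b \<otimes> g') \<otimes> x \<oplus> b \<otimes> c"
      unfolding f'(3) g'(3) using c x(1) by algebra
    moreover have "f' \<otimes> (g' \<otimes> x \<oplus> c) \<oplus> b \<otimes> g' \<in> C"
      using f' g' BC xC by (auto intro!: Cs)
    ultimately have "b \<otimes> c = \<zero>" using N_iff fg f' g' Bs(4) by metis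
    then show ?thesis using N_iff f' g' c integral by metis
  qed
  have factor: "\<exists>k::nat. \<exists>g\<in>C - N. f = x [^] k \<otimes> g" if "f \<in> C" "f \<noteq> \<zero>" for f
    using that(1)[unfolded C_def] that(2)
  proof (induction rule: simple_extension.induct)
    case zero
    then show ?case by simp
  next
    case (lin f b)
    note f = lin.hyps(1)[folded C_def] and b = lin.hyps(2)
    have fx: "f \<otimes> x \<oplus> b \<in> C" using lin.hyps unfolding C_def by (rule simple_extension.lin)
    show ?case
    proof (cases "b = \<zero>")
      case True
      then have "f \<noteq> \<zero>" using lin.prems x by auto
      then obtain k :: nat and g where g: "g \<in> C - N" "f = x [^] k \<otimes> g" using lin.IH by blast
      have "f \<otimes> x \<oplus> b = x [^] Suc k \<otimes> g" using True g x by (simp add: m_ac)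
      then show ?thesis using g by blast
    next
      case False
      then have "f \<otimes> x \<oplus> b \<in> C - N" using N_iff[OF f b] fx by blast
      moreover have "f \<otimes> x \<oplus> b = x [^] (0::nat) \<otimes> (f \<otimes> x \<oplus> b)" using fx by simp
      ultimately show ?thesis by blast
    qed
  qed
  show thesis using dvr_localization[OF C xC nonunit N_def prime factor] that by blast
qed

text \<open>Substituting \<open>1 + x\<close> for \<open>x\<close> is an automorphism of the
  polynomial ring over \<open>B\<close>, so transcendence is preserved.\<close>

lemma free_over_one_plus:
  assumes B: "subring B R" and x: "x \<in> carrier R" "x \<noteq> \<zero>" and free: "free_over B x"
  shows "free_over B (\<one> \<oplus> x)"
proof -
  note Bs = subringE(2-3,5-7)[OF B]
  have E: "subring (simple_extension B x) R" by (rule simple_extension_is_subring[OF B x(1)])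
  note Es = subringE(2-3,5-7)[OF E]
  have BE: "B \<subseteq> simple_extension B x" by (rule simple_extension_incl[OF subringE(1)[OF B] x(1)])
  have Bc: "b \<in> carrier R" if "b \<in> B" for b using subringE(1)[OF B] that by blast
  have Ec: "b \<in> carrier R" if "b \<in> simple_extension B x" for b using subringE(1)[OF E] that by blast
  have x1: "\<one> \<oplus> x \<in> simple_extension B x"
    using Es simple_extension_mem[OF B x(1)] by simp
  \<comment> \<open>A degree argument carried out by comparing coefficients: if
    \<open>(f x + b)(1 + x)\<close> is a constant, then \<open>f (1 + x) + b = 0\<close>, so
    \<open>f (1 + x)\<close> is a constant too and induction gives \<open>f = 0\<close>.\<close>
  have *: "p = \<zero>" if "p \<in> simple_extension B x" "p \<otimes> (\<one> \<oplus> x) = c" "c \<in> B" for p c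
    using that
  proof (induction arbitrary: c rule: simple_extension.induct)
    case zero
    show ?case by simp
  next
    case (lin f b)
    have c: "f \<in> carrier R" "b \<in> carrier R" "c \<in> carrier R" using lin Ec Bc by auto
    have "(f \<otimes> x \<oplus> b) \<otimes> (\<one> \<oplus> x) = (f \<otimes> (\<one> \<oplus> x) \<oplus> b) \<otimes> x \<oplus> b" using c(1,2) x(1) by algebra
    then have eq: "(f \<otimes> (\<one> \<oplus> x) \<oplus> b) \<otimes> x \<oplus> b = \<zero> \<otimes> x \<oplus> c"
      using lin.prems c x by simp
    have "f \<otimes> (\<one> \<oplus> x) \<oplus> b \<in> simple_extension B x"
      using Es(5)[OF Es(4)[OF lin.hyps(1) x1]] BE lin.hyps(2) by blast
    then have fb: "f \<otimes> (\<one> \<oplus> x) \<oplus> b = \<zero>"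
      using free_over_unique(1)[OF free B x _ lin.hyps(2) Es(1) lin.prems(2) eq] by blast
    then have "f \<otimes> (\<one> \<oplus> x) = \<ominus> b" using c x by (intro sum_zero_eq_neg) auto
    then have "f = \<zero>" using lin.IH[of "\<ominus> b"] Bs(3) lin.hyps(2) by blast
    moreover from this have "b = \<zero>" using fb c x by simp
    ultimately show ?case using x by simp
  qed
  have "b = \<zero>"
    if h: "h \<in> simple_extension B (\<one> \<oplus> x)" and b: "b \<in> B" and eq: "h \<otimes> (\<one> \<oplus> x) \<oplus> b = \<zero>" for h b
  proof -
    have hE: "h \<in> simple_extension B x" using simple_extension_subring_incl[OF E BE x1] h by blast
    then have "h \<otimes> (\<one> \<oplus> x) = \<ominus> b" using eq Ec Bc b x by (intro sum_zero_eq_neg) auto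
    then have "h = \<zero>" using *[OF hE _ Bs(3)[OF b]] by blast
    then show ?thesis using eq Bc[OF b] x by simp
  qed
  then show ?thesis by (auto simp: free_over_def)
qed

text \<open>\<open>B\<close> is a field by \<open>inv\<close>. In a relation
  \<open>h x + b = 0\<close> with \<open>b\<close> nonzero, dividing by \<open>-b\<close> exhibits
  the inverse of \<open>x\<close> as a polynomial in \<open>x\<close>.\<close>

lemma not_free_over_inverse:
  assumes B: "subring B R" and x: "x \<in> carrier R" and nfree: "\<not> free_over B x"
    and inv: "\<And>b. \<lbrakk>b \<in> B; b \<noteq> \<zero>\<rbrakk> \<Longrightarrow> \<exists>c\<in>B. c \<otimes> b = \<one>"
  obtains g where "g \<in> simple_extension B x" "g \<otimes> x = \<one>"
proof -
  have E: "subring (simple_extension B x) R" by (rule simple_extension_is_subring[OF B x])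
  note Es = subringE(2-3,5-7)[OF E]
  have BE: "B \<subseteq> simple_extension B x" by (rule simple_extension_incl[OF subringE(1)[OF B] x])
  obtain h b where h: "h \<in> simple_extension B x" "b \<in> B" "h \<otimes> x \<oplus> b = \<zero>" "b \<noteq> \<zero>"
    using nfree by (auto simp: free_over_def)
  obtain c where c: "c \<in> B" "c \<otimes> b = \<one>" using inv h by blast
  have cc: "h \<in> carrier R" "b \<in> carrier R" "c \<in> carrier R"
    using h c subringE(1)[OF E] subringE(1)[OF B] by auto
  have "h \<otimes> x = \<ominus> b" using h cc x by (intro sum_zero_eq_neg) auto
  moreover have "(\<ominus> c \<otimes> h) \<otimes> x = \<ominus> c \<otimes> (h \<otimes> x)" using cc x by (simp add: m_assoc)
  moreover have "\<ominus> c \<otimes> \<ominus> b = c \<otimes> b" using cc(2,3) by algebra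
  ultimately have "(\<ominus> c \<otimes> h) \<otimes> x = \<one>" using c by simp
  moreover have "\<ominus> c \<otimes> h \<in> simple_extension B x" using c BE h Es by blast
  ultimately show thesis using that by blast
qed

lemma int_embed_pow: "int_embed m [^] (n::nat) = int_embed (m ^ n)"
proof (induction n)
  case 0
  then show ?case by (simp add: int_embed_1)
next
  case (Suc n)
  then show ?case by (simp add: int_embed_mult mult.commute)
qed

text \<open>In characteristic zero the integers embed into the field, and the ring obtained is their
  localization at the prime \<open>p\<close>.\<close>

lemma dvr_at_prime:
  fixes p :: int
  assumes char: "\<And>n. n \<noteq> 0 \<Longrightarrow> int_embed n \<noteq> \<zero>" and p: "Factorial_Ring.prime p"
  obtains V where "dvr V (int_embed p)"
proof -
  define C where "C = range int_embed"
  define N where "N = (\<otimes>) (int_embed p) ` C"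
  have inj: "m = n" if "int_embed m = int_embed n" for m n
  proof -
    have "int_embed (m - n) = int_embed m \<oplus> \<ominus> int_embed n"
      by (simp add: int_embed_add int_embed_neg)
    then have "int_embed (m - n) = \<zero>" using that by (simp add: r_neg)
    then show ?thesis using char[of "m - n"] by auto
  qed
  have N_iff: "int_embed n \<in> N \<longleftrightarrow> p dvd n" for n
  proof
    assume "int_embed n \<in> N"
    then obtain k where "int_embed n = int_embed (p * k)"
      by (auto simp: N_def C_def int_embed_mult)
    then show "p dvd n" using inj by (metis dvd_triv_left)
  next
    assume "p dvd n"
    then obtain k where "n = p * k" ..
    then show "int_embed n \<in> N"
      unfolding N_def C_def by (auto simp flip: int_embed_mult)
  qed
  have C: "subring C R" unfolding C_def by (rule int_embed_subring)
  have pC: "int_embed p \<in> C" by (simp add: C_def)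
  have nonunit: "int_embed p \<otimes> c \<noteq> \<one>" if "c \<in> C" for c
  proof
    assume "int_embed p \<otimes> c = \<one>"
    then have "int_embed 1 \<in> N" using that unfolding int_embed_1 N_def by (metis imageI)
    then show False using N_iff[of 1] p not_prime_unit by blast
  qed
  have prime: "f \<in> N \<or> g \<in> N" if f: "f \<in> C" and g: "g \<in> C" and fg: "f \<otimes> g \<in> N" for f g
  proof -
    obtain m n where mn: "f = int_embed m" "g = int_embed n" using f g by (auto simp: C_def)
    then have "p dvd m * n" using fg by (simp add: int_embed_mult N_iff)
    then show ?thesis using mn N_iff p prime_dvd_mult_iff by blast
  qed
  have factor: "\<exists>k::nat. \<exists>g\<in>C - N. f = int_embed p [^] k \<otimes> g" if f: "f \<in> C" "f \<noteq> \<zero>" for f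
  proof -
    obtain n where n: "f = int_embed n" using f by (auto simp: C_def)
    then have "n \<noteq> 0" using f int_embed_0 by metis
    moreover have "\<not> is_unit p" using p not_prime_unit by blast
    ultimately obtain m where m: "n = p ^ multiplicity p n * m" "\<not> p dvd m"
      using multiplicity_decompose' by metis
    have "f = int_embed p [^] multiplicity p n \<otimes> int_embed m"
      unfolding n by (simp add: int_embed_pow int_embed_mult flip: m(1))
    moreover have "int_embed m \<in> C - N" using m N_iff by (simp add: C_def)
    ultimately show ?thesis by blast
  qed
  show thesis using dvr_localization[OF C pC nonunit N_def prime factor] that by blast
qed

text \<open>In positive characteristic the image of the integers is the prime field. The primality
  of the characteristic enters only as a statement about gcds, followed by Bezout's
  identity.\<close>

lemma int_embed_inverse:
  assumes n: "n \<noteq> 0" "int_embed n = \<zero>" and b: "b \<in> range int_embed" "b \<noteq> \<zero>"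
  shows "\<exists>c\<in>range int_embed. c \<otimes> b = \<one>"
proof -
  define P where "P k \<longleftrightarrow> k > 0 \<and> int_embed (int k) = \<zero>" for k
  have "P (nat \<bar>n\<bar>)" using n int_embed_neg[of n] by (auto simp: P_def abs_if)
  then have q: "P (Least P)" by (rule LeastI)
  define q where "q = Least P"
  obtain m where m: "b = int_embed m" using b by blast
  \<comment> \<open>\<open>q\<close> is the characteristic. Since \<open>g\<close> divides
    \<open>m\<close> and \<open>b\<close> is nonzero, \<open>g\<close> does not map to zero; so
    \<open>q / g\<close> does, and minimality of \<open>q\<close> leaves only
    \<open>g = 1\<close>.\<close>
  define g where "g = nat (gcd m (int q))"
  have g: "int g dvd m" "g dvd q" "g > 0" using q by (auto simp: g_def P_def q_def nat_dvd_iff)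
  obtain r where r: "q = g * r" using g by blast
  have "int_embed (int g) \<otimes> int_embed (int r) = \<zero>"
    using q by (simp add: int_embed_mult P_def q_def[symmetric] r)
  moreover have "int_embed (int g) \<noteq> \<zero>"
  proof
    assume "int_embed (int g) = \<zero>"
    moreover obtain l where "m = int g * l" using g by blast
    ultimately have "b = \<zero>" unfolding m by (simp flip: int_embed_mult)
    then show False using b by simp
  qed
  ultimately have "int_embed (int r) = \<zero>" using integral by auto
  then have "P r" using r q by (auto simp: P_def q_def[symmetric])
  then have "q \<le> r" unfolding q_def by (rule Least_le)
  then have "g = 1" using r g q by (auto simp: P_def q_def[symmetric])
  then have "coprime m (int q)" by (simp add: g_def coprime_iff_gcd_eq_1 nat_eq_iff)
  then obtain x y where "int_embed x \<otimes> int_embed m \<oplus> int_embed y \<otimes> int_embed (int q) = \<one>"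
    using int_embed_coprime by blast
  then have "int_embed x \<otimes> b = \<one>" using q m by (simp add: P_def q_def[symmetric])
  then show ?thesis by blast
qed

end

text \<open>Otherwise every prime number lies in a maximal ideal. Two different primes are coprime
  and cannot share one, so there would be infinitely many maximal ideals.\<close>

lemma (in cring) semi_local_prime_unit:
  assumes "semi_local R"
  obtains p :: int where "Factorial_Ring.prime p" "int_embed p \<in> Units R"
proof -
  have "\<exists>p::int. Factorial_Ring.prime p \<and> int_embed p \<in> Units R"
  proof (rule ccontr)
    assume "\<not> ?thesis"
    then have "\<exists>M. maximalideal M R \<and> int_embed p \<in> M" if "Factorial_Ring.prime p" for p :: int
      using nonunit_in_maximalideal[of "int_embed p"] that by auto
    then obtain F where F: "\<And>p::int. Factorial_Ring.prime p \<Longrightarrow> maximalideal (F p) R \<and> int_embed p \<in> F p"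
      by metis
    have "inj_on F {p. Factorial_Ring.prime p}"
    proof (rule inj_onI, rule ccontr)
      fix p q :: int assume pq: "p \<in> {p. Factorial_Ring.prime p}" "q \<in> {p. Factorial_Ring.prime p}" "F p = F q" "p \<noteq> q"
      then have "coprime p q" using primes_coprime by auto
      then obtain a b where ab: "int_embed a \<otimes> int_embed p \<oplus> int_embed b \<otimes> int_embed q = \<one>"
        using int_embed_coprime by blast
      interpret M: maximalideal "F p" R using F pq by blast
      have "int_embed a \<otimes> int_embed p \<oplus> int_embed b \<otimes> int_embed q \<in> F p"
        using F[of p] F[of q] pq by (intro M.a_closed M.I_l_closed) auto
      then show False using maximalideal_not_one F pq unfolding ab by blast
    qed
    moreover have "F ` {p. Factorial_Ring.prime p} \<subseteq> MaxSpec R" using F by (auto simp: MaxSpec_def)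
    ultimately have "finite {p::int. Factorial_Ring.prime p}"
      using assms unfolding semi_local_def by (metis finite_imageD finite_subset)
    then have "finite (int ` {p::nat. Factorial_Ring.prime p})" by (rule rev_finite_subset) auto
    then have "finite {p::nat. Factorial_Ring.prime p}" by (rule finite_imageD) (auto intro: inj_onI)
    then show False using primes_infinite by blast
  qed
  then show thesis using that by blast
qed

text \<open>For a prime ideal the quotient is only a domain; \<open>K\<close> is its field of
  fractions, obtained as the localization at all nonzero elements.\<close>

lemma (in primeideal) residue_field:
  obtains K :: "('a set \<times> 'a set) set ring" and h
  where "field K" "h \<in> ring_hom R K" "\<And>a. a \<in> carrier R \<Longrightarrow> h a = \<zero>\<^bsub>K\<^esub> \<longleftrightarrow> a \<in> I"
proof -
  define D where "D = R Quot I"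
  interpret D: domain D unfolding D_def by (rule quotient_is_domain)
  define S where "S = carrier D - {\<zero>\<^bsub>D\<^esub>}"
  have "submonoid S D"
    by (rule submonoid.intro) (auto simp: S_def D.integral_iff)
  then interpret D: mult_closed D S
    by (intro mult_closed.intro D.cring_axioms)
  define K where "K = localization D S"
  interpret K: cring K unfolding K_def by (rule D.localization_cring)
  have one: "\<one>\<^bsub>D\<^esub> \<in> S" by (rule D.one_closed)
  have zero_iff: "loc_frac D S a s = \<zero>\<^bsub>K\<^esub> \<longleftrightarrow> a = \<zero>\<^bsub>D\<^esub>" if a: "a \<in> carrier D" and s: "s \<in> S" for a s
  proof -
    have "loc_frac D S a s = \<zero>\<^bsub>K\<^esub> \<longleftrightarrow>
        (\<exists>u\<in>S. u \<otimes>\<^bsub>D\<^esub> (a \<otimes>\<^bsub>D\<^esub> \<one>\<^bsub>D\<^esub>) = u \<otimes>\<^bsub>D\<^esub> (\<zero>\<^bsub>D\<^esub> \<otimes>\<^bsub>D\<^esub> s))"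
      unfolding K_def D.localization_zero
      by (rule D.loc_frac_iff[OF a s D.zero_closed one])
    also have "\<dots> \<longleftrightarrow> (\<exists>u\<in>S. u \<otimes>\<^bsub>D\<^esub> a = \<zero>\<^bsub>D\<^esub>)"
      using a s by (intro bex_cong) auto
    also have "\<dots> \<longleftrightarrow> a = \<zero>\<^bsub>D\<^esub>"
      using a one D.integral unfolding S_def by (metis D.r_null Diff_iff insertCI)
    finally show ?thesis .
  qed
  have "field K"
  proof (rule K.cring_fieldI2)
    show "\<zero>\<^bsub>K\<^esub> \<noteq> \<one>\<^bsub>K\<^esub>"
      using zero_iff[OF _ one, of "\<one>\<^bsub>D\<^esub>"] unfolding K_def D.localization_one by auto
    fix A assume A: "A \<in> carrier K" "A \<noteq> \<zero>\<^bsub>K\<^esub>"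
    then obtain a s where a: "A = loc_frac D S a s" "a \<in> carrier D" "s \<in> S"
      using D.localization_carrierE[of A] unfolding K_def by metis
    have sc: "s \<in> carrier D" using a(3) by (rule D.S_carr)
    have "a \<noteq> \<zero>\<^bsub>D\<^esub>" using A(2) a(1) zero_iff[OF a(2,3)] by simp
    then have aS: "a \<in> S" using a(2) unfolding S_def by blast
    have "A \<otimes>\<^bsub>K\<^esub> loc_frac D S s a = loc_frac D S (a \<otimes>\<^bsub>D\<^esub> s) (s \<otimes>\<^bsub>D\<^esub> a)"
      unfolding K_def a(1) by (rule D.localization_mult[OF a(2,3) sc aS])
    also have "\<dots> = \<one>\<^bsub>K\<^esub>"
      unfolding K_def D.localization_one
      by (rule D.loc_frac_eqI) (use a(2,3) aS sc one in \<open>simp_all add: D.m_comm\<close>)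
    finally have "A \<otimes>\<^bsub>K\<^esub> loc_frac D S s a = \<one>\<^bsub>K\<^esub>" .
    moreover have "loc_frac D S s a \<in> carrier K"
      unfolding K_def by (rule D.loc_frac_carrier[OF sc aS])
    ultimately show "\<exists>B\<in>carrier K. A \<otimes>\<^bsub>K\<^esub> B = \<one>\<^bsub>K\<^esub>" by blast
  qed
  moreover define h where "h = loc_map D S \<circ> (+>) I"
  have "h \<in> ring_hom R K"
    unfolding h_def K_def by (rule ring_hom_trans[OF _ D.loc_map_hom]) (simp add: D_def rcos_ring_hom)
  moreover have "h a = \<zero>\<^bsub>K\<^esub> \<longleftrightarrow> a \<in> I" if a: "a \<in> carrier R" for a
  proof -
    have "I +> a \<in> carrier D"
      using ring_hom_closed[OF rcos_ring_hom a] by (simp add: D_def)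
    then have "h a = \<zero>\<^bsub>K\<^esub> \<longleftrightarrow> I +> a = \<zero>\<^bsub>D\<^esub>"
      using zero_iff[OF _ one, of "I +> a"] by (simp add: h_def loc_map_def)
    also have "\<dots> \<longleftrightarrow> a \<in> I"
      using a a_rcos_const a_rcos_self by (auto simp: D_def FactRing_def)
    finally show ?thesis .
  qed
  ultimately show thesis using that by blast
qed

section \<open>Semi-local rings without maximal subrings\<close>

text \<open>Without maximal subrings, \<open>h x\<close> must be algebraic over a finite prime
  field, so its inverse is a polynomial in \<open>h x\<close> and comes from \<open>U\<close>. The
  choice \<open>p = x\<close> serves for elements invertible modulo a prime, the choice
  \<open>p = 1 + x\<close> for elements of the Jacobson radical.\<close>

lemma not_submaximal_inverse:
  assumes T: "cring T" "semi_local T" "\<not> submaximal T" and K: "field K" and h: "h \<in> ring_hom T K"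
    and U: "subring U T" and x: "x \<in> U" "h x \<noteq> \<zero>\<^bsub>K\<^esub>"
    and p: "p = x \<or> p = \<one>\<^bsub>T\<^esub> \<oplus>\<^bsub>T\<^esub> x"
    and z: "z \<in> carrier T" "h p \<otimes>\<^bsub>K\<^esub> h z = \<one>\<^bsub>K\<^esub>"
  obtains u where "u \<in> U" "h u \<otimes>\<^bsub>K\<^esub> h x = \<one>\<^bsub>K\<^esub>"
proof -
  interpret T: cring T by fact
  interpret K: field K by fact
  interpret h: ring_hom_cring T K h using h by unfold_locales
  have xT: "x \<in> carrier T" using x subringE(1)[OF U] by blast
  then have pT: "p \<in> carrier T" using p by auto
  have hx: "h x \<in> carrier K" and hp: "h p \<in> carrier K" and hz: "h z \<in> carrier K"
    using xT pT z(1) by auto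
  have hp0: "h p \<noteq> \<zero>\<^bsub>K\<^esub>" using z(2) hz by auto
  \<comment> \<open>In characteristic zero, the integers localized at a prime number
    \<open>q\<close> that is a unit of \<open>T\<close> would produce a maximal subring of
    \<open>T\<close>.\<close>
  have "\<exists>n. n \<noteq> 0 \<and> K.int_embed n = \<zero>\<^bsub>K\<^esub>"
  proof (rule ccontr)
    assume *: "\<not> ?thesis"
    obtain q :: int where q: "Factorial_Ring.prime q" "T.int_embed q \<in> Units T"
      using T.semi_local_prime_unit[OF T(2)] by metis
    obtain V where V: "K.dvr V (K.int_embed q)" using K.dvr_at_prime[OF _ q(1)] * by blast
    have hq: "h (T.int_embed q) = K.int_embed q"
      by (rule ring_hom_int_embed[OF h T.ring_axioms K.ring_axioms])
    obtain q' where q': "q' \<in> carrier T" "T.int_embed q \<otimes>\<^bsub>T\<^esub> q' = \<one>\<^bsub>T\<^esub>"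
      using q(2) by (auto simp: Units_def)
    have qT: "T.int_embed q \<in> carrier T" by simp
    have "h (T.int_embed q) \<otimes>\<^bsub>K\<^esub> h q' = \<one>\<^bsub>K\<^esub>"
      using h.hom_mult[OF qT q'(1)] q'(2) by simp
    then show False
      using submaximal_of_dvr[OF T(1) K h qT q'(1)] V hq T(3) by metis
  qed
  then obtain n where n: "n \<noteq> 0" "K.int_embed n = \<zero>\<^bsub>K\<^esub>" by blast
  define B where "B = range K.int_embed"
  have B: "subring B K" unfolding B_def by (rule K.int_embed_subring)
  \<comment> \<open>If \<open>h x\<close> were transcendental, so would be \<open>h p\<close>, and
    \<open>h p\<close> would be the uniformizer of a discrete valuation ring while having the
    inverse \<open>h z\<close>.\<close>
  have "\<not> K.free_over B (h x)"
  proof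
    assume *: "K.free_over B (h x)"
    have "h (\<one>\<^bsub>T\<^esub> \<oplus>\<^bsub>T\<^esub> x) = \<one>\<^bsub>K\<^esub> \<oplus>\<^bsub>K\<^esub> h x" using xT by simp
    then have "K.free_over B (h p)"
      using * K.free_over_one_plus[OF B hx x(2) *] p by auto
    then obtain V where "K.dvr V (h p)" using K.dvr_of_free[OF B hp hp0] by blast
    then show False using submaximal_of_dvr[OF T(1) K h pT z] T(3) by blast
  qed
  then obtain g where g: "g \<in> K.simple_extension B (h x)" "g \<otimes>\<^bsub>K\<^esub> h x = \<one>\<^bsub>K\<^esub>"
    using K.not_free_over_inverse[OF B hx] K.int_embed_inverse[OF n] unfolding B_def by metis
  have hU: "subring (h ` U) K" by (rule h.ring.img_is_subring[OF U])
  have "T.int_embed k \<in> U" for k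
  proof -
    have "subgroup U (add_monoid T)" using U subring.axioms(1) by blast
    then have "pow (add_monoid T) \<one>\<^bsub>T\<^esub> k \<in> U"
      by (rule group.subgroup_int_pow_closed[OF T.a_group _ subringE(3)[OF U]])
    then show ?thesis by (simp add: add_pow_def)
  qed
  then have "h (T.int_embed k) \<in> h ` U" for k by blast
  then have "B \<subseteq> h ` U"
    unfolding B_def ring_hom_int_embed[OF h T.ring_axioms K.ring_axioms] by blast
  then have "K.simple_extension B (h x) \<subseteq> h ` U"
    using K.simple_extension_subring_incl[OF hU] x(1) by blast
  then show thesis using g that by blast
qed

text \<open>No maximal ideal is contained in \<open>P\<close>. Choosing an element outside
  \<open>P\<close> from each of them, the finite product lies in the Jacobson radical and,
  \<open>P\<close> being prime, still outside \<open>P\<close>.\<close>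

lemma (in cring) semi_local_nonmaximal_prime:
  assumes "semi_local R" and P: "primeideal P R" "\<not> maximalideal P R"
  obtains x where "x \<in> carrier R" "x \<notin> P" "\<And>M. maximalideal M R \<Longrightarrow> x \<in> M"
proof -
  interpret P: primeideal P R by fact
  have "\<exists>x\<in>carrier R. x \<notin> P \<and> (\<forall>M\<in>F. x \<in> M)" if "finite F" "F \<subseteq> MaxSpec R" for F
    using that
  proof (induction rule: finite_induct)
    case empty
    show ?case using P.I_notcarr P.one_imp_carrier by blast
  next
    case (insert M F)
    then obtain x where x: "x \<in> carrier R" "x \<notin> P" "\<forall>M\<in>F. x \<in> M" by auto
    have "maximalideal M R" using insert by (simp add: MaxSpec_def)
    then interpret M: maximalideal M R .
    have "\<not> M \<subseteq> P"
    proof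
      assume "M \<subseteq> P"
      then have "P = M"
        using M.I_maximal[OF P.is_ideal _ P.a_subset] P.I_notcarr by blast
      then show False using P(2) M.maximalideal_axioms by simp
    qed
    then obtain m where m: "m \<in> M" "m \<notin> P" by blast
    then have mc: "m \<in> carrier R" using M.Icarr by blast
    have "m \<otimes> x \<in> M'" if "M' \<in> insert M F" for M'
    proof (cases "M' = M")
      case True
      then show ?thesis using m x M.I_r_closed by blast
    next
      case False
      then have "M' \<in> F" using that by blast
      then have "ideal M' R" using insert.prems maximalideal.axioms(1) by (auto simp: MaxSpec_def)
      then show ?thesis using x mc \<open>M' \<in> F\<close> ideal.I_l_closed by metis
    qed
    moreover have "m \<otimes> x \<notin> P" using P.I_prime[OF mc x(1)] m x by blast
    ultimately show ?case using mc x by blast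
  qed
  then show thesis using assms(1) that unfolding semi_local_def MaxSpec_def by blast
qed

lemma not_submaximal_prime_maximal:
  assumes T: "cring T" "semi_local T" "\<not> submaximal T" and P: "primeideal P T"
  shows "maximalideal P T"
proof (rule ccontr)
  assume nmax: "\<not> maximalideal P T"
  interpret T: cring T by fact
  interpret P: primeideal P T by fact
  obtain x where x: "x \<in> carrier T" "x \<notin> P" "\<And>M. maximalideal M T \<Longrightarrow> x \<in> M"
    using T.semi_local_nonmaximal_prime[OF T(2) P nmax] by blast
  have x1: "\<one>\<^bsub>T\<^esub> \<oplus>\<^bsub>T\<^esub> x \<in> carrier T" using x by simp
  have "\<one>\<^bsub>T\<^esub> \<oplus>\<^bsub>T\<^esub> x \<in> Units T"
  proof (rule ccontr)
    assume "\<one>\<^bsub>T\<^esub> \<oplus>\<^bsub>T\<^esub> x \<notin> Units T"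
    then obtain M where M: "maximalideal M T" "\<one>\<^bsub>T\<^esub> \<oplus>\<^bsub>T\<^esub> x \<in> M"
      using T.nonunit_in_maximalideal[OF x1] by blast
    interpret M: maximalideal M T by fact
    have "(\<one>\<^bsub>T\<^esub> \<oplus>\<^bsub>T\<^esub> x) \<oplus>\<^bsub>T\<^esub> \<ominus>\<^bsub>T\<^esub> x \<in> M" 
      by (rule M.a_closed[OF M(2) M.a_inv_closed[OF x(3)[OF M(1)]]])
    moreover have "(\<one>\<^bsub>T\<^esub> \<oplus>\<^bsub>T\<^esub> x) \<oplus>\<^bsub>T\<^esub> \<ominus>\<^bsub>T\<^esub> x = \<one>\<^bsub>T\<^esub>" using x by (simp add: T.a_assoc T.r_neg)
    ultimately show False using T.maximalideal_not_one[OF M(1)] by simp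
  qed
  then obtain z where z: "z \<in> carrier T" "(\<one>\<^bsub>T\<^esub> \<oplus>\<^bsub>T\<^esub> x) \<otimes>\<^bsub>T\<^esub> z = \<one>\<^bsub>T\<^esub>" by (auto simp: Units_def)
  obtain K :: "('a set \<times> 'a set) set ring" and h where K: "field K" and h: "h \<in> ring_hom T K"
    and ker: "\<And>a. a \<in> carrier T \<Longrightarrow> h a = \<zero>\<^bsub>K\<^esub> \<longleftrightarrow> a \<in> P"
    using P.residue_field by metis
  interpret K: field K by fact
  interpret h: ring_hom_cring T K h using h by unfold_locales
  have "h (\<one>\<^bsub>T\<^esub> \<oplus>\<^bsub>T\<^esub> x) \<otimes>\<^bsub>K\<^esub> h z = \<one>\<^bsub>K\<^esub>" using h.hom_mult[OF x1 z(1)] z(2) by simp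
  \<comment> \<open>Applied with \<open>p = 1 + x\<close>, which is a unit although \<open>x\<close>
    lies in every maximal ideal. The resulting inverse of \<open>x\<close> modulo \<open>P\<close>
    puts 1 into any maximal ideal above \<open>P\<close>.\<close>
  then obtain u where u: "u \<in> carrier T" "h u \<otimes>\<^bsub>K\<^esub> h x = \<one>\<^bsub>K\<^esub>"
    using not_submaximal_inverse[OF T K h T.carrier_is_subring x(1) _ _ z(1)] x ker by metis
  have ux: "u \<otimes>\<^bsub>T\<^esub> x \<in> carrier T" using u x by simp
  have "h (\<one>\<^bsub>T\<^esub> \<oplus>\<^bsub>T\<^esub> \<ominus>\<^bsub>T\<^esub> (u \<otimes>\<^bsub>T\<^esub> x)) = \<zero>\<^bsub>K\<^esub>" using u x ux by (simp add: K.r_neg)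
  then have uP: "\<one>\<^bsub>T\<^esub> \<oplus>\<^bsub>T\<^esub> \<ominus>\<^bsub>T\<^esub> (u \<otimes>\<^bsub>T\<^esub> x) \<in> P"
    using ker[of "\<one>\<^bsub>T\<^esub> \<oplus>\<^bsub>T\<^esub> \<ominus>\<^bsub>T\<^esub> (u \<otimes>\<^bsub>T\<^esub> x)"] ux by simp
  have "\<one>\<^bsub>T\<^esub> \<notin> P" using P.I_notcarr P.one_imp_carrier by blast
  then obtain M where M: "maximalideal M T" "P \<subseteq> M" using T.maximalideal_above[OF P.is_ideal] by blast
  interpret M: maximalideal M T by fact
  have "u \<otimes>\<^bsub>T\<^esub> x \<in> M" using M.I_l_closed[OF x(3)[OF M(1)] u(1)] .
  then have "(\<one>\<^bsub>T\<^esub> \<oplus>\<^bsub>T\<^esub> \<ominus>\<^bsub>T\<^esub> (u \<otimes>\<^bsub>T\<^esub> x)) \<oplus>\<^bsub>T\<^esub> u \<otimes>\<^bsub>T\<^esub> x \<in> M"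
    using uP M(2) M.a_closed by blast
  moreover have "(\<one>\<^bsub>T\<^esub> \<oplus>\<^bsub>T\<^esub> \<ominus>\<^bsub>T\<^esub> (u \<otimes>\<^bsub>T\<^esub> x)) \<oplus>\<^bsub>T\<^esub> u \<otimes>\<^bsub>T\<^esub> x = \<one>\<^bsub>T\<^esub>"
    using ux by (simp add: T.a_assoc T.l_neg)
  ultimately show False using T.maximalideal_not_one[OF M(1)] by simp
qed

section \<open>Tools for pulling back maximal subrings and lifting inverses\<close>

text \<open>The preimage of a maximal subring is maximal: it contains the kernel, and a subring
  containing the kernel is determined by its image.\<close>

lemma submaximal_surjective_hom:
  assumes R: "ring R" and T: "ring T" and h: "h \<in> ring_hom R T" and surj: "h ` carrier R = carrier T"
    and T_sub: "submaximal T"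
  shows "submaximal R"
proof -
  interpret h: ring_hom_ring R T h by (rule ring_hom_ringI2[OF R T h])
  obtain V where V: "subring V T" "V \<subset> carrier T"
    and max: "\<not> (\<exists>U. subring U T \<and> V \<subset> U \<and> U \<subset> carrier T)"
    using T_sub by (auto simp: submaximal_def maximal_subring_def)
  note Vs = subringE(2-3,5-7)[OF V(1)]
  define W where "W = {r \<in> carrier R. h r \<in> V}"
  have "subring W R"
    by (rule h.R.subringI) (auto simp: W_def Vs)
  moreover have "W \<subset> carrier R"
  proof -
    obtain t where t: "t \<in> carrier T" "t \<notin> V" using V(2) by blast
    then obtain r where "r \<in> carrier R" "t = h r" using surj by blast
    then show ?thesis using t by (auto simp: W_def)
  qed
  moreover have "\<not> (\<exists>U. subring U R \<and> W \<subset> U \<and> U \<subset> carrier R)"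
  proof
    assume "\<exists>U. subring U R \<and> W \<subset> U \<and> U \<subset> carrier R"
    then obtain U where U: "subring U R" "W \<subset> U" "U \<subset> carrier R" by blast
    have UR: "U \<subseteq> carrier R" using U by blast
    have hU: "subring (h ` U) T" by (rule h.img_is_subring[OF U(1)])
    have "V \<subseteq> h ` U"
    proof
      fix t assume t: "t \<in> V"
      then obtain r where "r \<in> carrier R" "t = h r" using surj V by blast
      then show "t \<in> h ` U" using t U(2) by (auto simp: W_def)
    qed
    moreover obtain u where "u \<in> U" "u \<notin> W" using U by blast
    then have "h u \<notin> V" "h u \<in> h ` U" using UR by (auto simp: W_def)
    ultimately have "V \<subset> h ` U" by blast
    then have full: "h ` U = carrier T" using max hU subringE(1)[OF hU] by blast
    have "carrier R \<subseteq> U"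
    proof
      fix r assume r: "r \<in> carrier R"
      then have "h r \<in> h ` U" using full by simp
      then obtain u where u: "u \<in> U" "h r = h u" by blast
      have uc: "u \<in> carrier R" using u UR by blast
      have "h (r \<oplus>\<^bsub>R\<^esub> \<ominus>\<^bsub>R\<^esub> u) = \<zero>\<^bsub>T\<^esub>" using r uc u(2) by (simp add: h.S.r_neg)
      then have "r \<oplus>\<^bsub>R\<^esub> \<ominus>\<^bsub>R\<^esub> u \<in> W"
        unfolding W_def using r uc Vs(1) by simp
      then have "(r \<oplus>\<^bsub>R\<^esub> \<ominus>\<^bsub>R\<^esub> u) \<oplus>\<^bsub>R\<^esub> u \<in> U" using U u subringE(7)[OF U(1)] by blast
      moreover have "(r \<oplus>\<^bsub>R\<^esub> \<ominus>\<^bsub>R\<^esub> u) \<oplus>\<^bsub>R\<^esub> u = r" using r uc by (simp add: h.R.a_assoc h.R.l_neg)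
      ultimately show "r \<in> U" by simp
    qed
    then show False using U by blast
  qed
  ultimately show ?thesis by (auto simp: submaximal_def maximal_subring_def)
qed

lemma (in cring) maximalideals_common_inverse:
  assumes "finite F" "F \<subseteq> MaxSpec R" and s: "s \<in> carrier R" "\<And>M. M \<in> F \<Longrightarrow> s \<notin> M"
  obtains a where "a \<in> carrier R" "\<And>M. M \<in> F \<Longrightarrow> \<one> \<ominus> a \<otimes> s \<in> M"
proof -
  have "\<exists>a\<in>carrier R. \<forall>M\<in>F. \<one> \<ominus> a \<otimes> s \<in> M"
    using assms
  proof (induction rule: finite_induct)
    case empty
    show ?case by blast
  next
    case (insert M F)
    then obtain a where a: "a \<in> carrier R" "\<forall>M\<in>F. \<one> \<ominus> a \<otimes> s \<in> M" by auto
    have M: "maximalideal M R" using insert by (simp add: MaxSpec_def)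
    then interpret M: maximalideal M R .
    obtain b where b: "b \<in> carrier R" "\<one> \<ominus> b \<otimes> s \<in> M"
      using maximalideal_inverse[OF M s(1)] insert.prems by blast
    \<comment> \<open>Chosen so that \<open>1 - c s = (1 - a s)(1 - b s)\<close>, which lies in
      \<open>M\<close> and in all members of \<open>F\<close>.\<close>
    define c where "c = a \<oplus> b \<ominus> a \<otimes> b \<otimes> s"
    have c: "\<one> \<ominus> c \<otimes> s = (\<one> \<ominus> a \<otimes> s) \<otimes> (\<one> \<ominus> b \<otimes> s)"
      unfolding c_def using a(1) b(1) s(1) by algebra
    have "\<one> \<ominus> c \<otimes> s \<in> M'" if "M' \<in> insert M F" for M'
    proof (cases "M' = M")
      case True
      then show ?thesis unfolding c using a b s M.I_l_closed by simp
    next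
      case False
      then have "M' \<in> F" using that by blast
      then have "ideal M' R" using insert.prems maximalideal.axioms(1) by (auto simp: MaxSpec_def)
      then show ?thesis unfolding c using a b(1) s(1) \<open>M' \<in> F\<close> by (intro ideal.I_r_closed) auto
    qed
    moreover have "c \<in> carrier R" using a b s by (simp add: c_def)
    ultimately show ?case by blast
  qed
  then show thesis using that by blast
qed

text \<open>A finite geometric series: with \<open>q = 1 - a s\<close>, the element
  \<open>1 - q^k\<close> equals \<open>e s\<close> for \<open>e = a (1 + q + ... + q^(k-1))\<close>,
  which lies in \<open>C\<close>. For \<open>k = n\<close> the power of \<open>q\<close>
  vanishes.\<close>

lemma (in cring) subring_inverse_of_nilpotent:
  assumes C: "subring C R" and s: "s \<in> C" and a: "a \<in> C" and nil: "(\<one> \<ominus> a \<otimes> s) [^] (n::nat) = \<zero>"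
  obtains e where "e \<in> C" "e \<otimes> s = \<one>"
proof -
  note Cs = subringE(2-3,5-7)[OF C]
  have c: "s \<in> carrier R" "a \<in> carrier R" using s a subringE(1)[OF C] by auto
  define q where "q = \<one> \<ominus> a \<otimes> s"
  have q: "q \<in> C" "q \<in> carrier R" using s a c by (simp_all add: q_def subring_minus[OF C] Cs)
  have "\<exists>e\<in>C. e \<otimes> s = \<one> \<ominus> q [^] k" for k :: nat
  proof (induction k)
    case 0
    show ?case using c Cs(1) by (intro bexI[of _ \<zero>]) (simp_all add: a_minus_def r_neg)
  next
    case (Suc k)
    then obtain e where e: "e \<in> C" "e \<otimes> s = \<one> \<ominus> q [^] k" by blast
    define t where "t = q [^] k"
    have t: "t \<in> carrier R" "e \<in> carrier R" using q e subringE(1)[OF C] by (auto simp: t_def)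
    have "(e \<otimes> q \<oplus> a) \<otimes> s = (e \<otimes> s) \<otimes> q \<oplus> a \<otimes> s" using t(2) q(2) c by algebra
    also have "\<dots> = (\<one> \<ominus> t) \<otimes> q \<oplus> a \<otimes> s" using e by (simp add: t_def)
    also have "\<dots> = q \<oplus> a \<otimes> s \<ominus> t \<otimes> q" using t(1) q(2) c by algebra
    also have "q \<oplus> a \<otimes> s = \<one>" unfolding q_def using c by algebra
    finally have "(e \<otimes> q \<oplus> a) \<otimes> s = \<one> \<ominus> q [^] Suc k" by (simp add: t_def)
    moreover have "e \<otimes> q \<oplus> a \<in> C" using e q a Cs by simp
    ultimately show ?case by blast
  qed
  from this[of n] obtain e where "e \<in> C" "e \<otimes> s = \<one> \<ominus> q [^] n" by blast
  then show thesis using that nil by (simp add: q_def a_minus_def)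
qed

section \<open>Localizations\<close>

context mult_closed
begin

abbreviation L where "L \<equiv> localization R S"

abbreviation contraction where "contraction Q \<equiv> {r \<in> carrier R. loc_map R S r \<in> Q}"

lemma loc_map_ring_hom_cring: "ring_hom_cring R L (loc_map R S)"
  by (intro ring_hom_cring.intro ring_hom_cring_axioms.intro is_cring localization_cring loc_map_hom)

lemma loc_frac_split:
  assumes "a \<in> carrier R" "s \<in> S"
  shows "loc_frac R S a s = loc_map R S a \<otimes>\<^bsub>L\<^esub> loc_frac R S \<one> s"
    and "loc_map R S a = loc_frac R S a s \<otimes>\<^bsub>L\<^esub> loc_map R S s"
proof -
  have "loc_frac R S a \<one> = loc_frac R S (a \<otimes> s) s"
    using assms by (intro loc_frac_eqI) auto
  then show "loc_map R S a = loc_frac R S a s \<otimes>\<^bsub>L\<^esub> loc_map R S s"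
    using assms by (simp add: loc_map_def localization_mult)
qed (use assms in \<open>simp add: loc_map_def localization_mult\<close>)

lemma loc_map_notin_prime:
  assumes Q: "primeideal Q L" and s: "s \<in> S"
  shows "loc_map R S s \<notin> Q"
proof
  assume *: "loc_map R S s \<in> Q"
  interpret Q: primeideal Q L by fact
  obtain t where "t \<in> carrier L" "t \<otimes>\<^bsub>L\<^esub> loc_map R S s = \<one>\<^bsub>L\<^esub>"
    using loc_map_Units[OF s] by (auto simp: Units_def)
  then have "\<one>\<^bsub>L\<^esub> \<in> Q" using Q.I_l_closed[OF *] by metis
  then show False using Q.I_notcarr Q.one_imp_carrier by blast
qed

lemma primeideal_contraction:
  assumes Q: "primeideal Q L"
  shows "primeideal (contraction Q) R"
proof -
  interpret Q: primeideal Q L by fact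
  interpret h: ring_hom_cring R L "loc_map R S" by (rule loc_map_ring_hom_cring)
  show ?thesis
  proof (rule primeidealI[OF h.ring.ideal_vimage[OF Q.is_ideal] is_cring])
    have "\<one>\<^bsub>L\<^esub> \<notin> Q" using Q.I_notcarr Q.one_imp_carrier by blast
    then have "\<one> \<notin> contraction Q" by simp
    then show "carrier R \<noteq> contraction Q" by blast
    show "a \<in> contraction Q \<or> b \<in> contraction Q"
      if "a \<in> carrier R" "b \<in> carrier R" "a \<otimes> b \<in> contraction Q" for a b
      using that Q.I_prime[of "loc_map R S a" "loc_map R S b"] by simp
  qed
qed

text \<open>A fraction \<open>a/s\<close> and its numerator \<open>a/1\<close> differ by the unit
  \<open>s/1\<close>, so an ideal of \<open>L\<close> is generated by the numerators in it.\<close>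

lemma loc_extension_contraction:
  assumes Q: "ideal Q L"
  shows "loc_extension R S (contraction Q) = Q"
proof
  interpret L: cring L by (rule localization_cring)
  interpret Q: ideal Q L by fact
  let ?J = "loc_extension R S (contraction Q)"
  have sub: "loc_map R S ` contraction Q \<subseteq> Q" by blast
  then show "?J \<subseteq> Q" unfolding loc_extension_def by (rule L.genideal_minimal[OF Q])
  have c: "loc_map R S ` contraction Q \<subseteq> carrier L" using sub Q.a_subset by blast
  have J: "ideal ?J L" unfolding loc_extension_def by (rule L.genideal_ideal[OF c])
  show "Q \<subseteq> ?J"
  proof
    fix A assume A: "A \<in> Q"
    then obtain a s where a: "A = loc_frac R S a s" "a \<in> carrier R" "s \<in> S"
      using Q.a_subset localization_carrierE by (metis subsetD)
    have sL: "loc_map R S s \<in> carrier L" using a by (simp add: loc_map_def)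
    have "loc_map R S a \<in> Q"
      using Q.I_r_closed[OF A sL] loc_frac_split(2)[OF a(2,3)] a(1) by simp
    then have "loc_map R S a \<in> ?J"
      using L.genideal_self[OF c] a(2) unfolding loc_extension_def by blast
    then show "A \<in> ?J"
      using ideal.I_r_closed[OF J] loc_frac_split(1)[OF a(2,3)] a loc_frac_carrier[OF S_carr[OF one_closed] a(3)]
      by simp
  qed
qed

lemma primeideal_extension:
  assumes P: "primeideal P R" and disj: "P \<inter> S = {}"
  defines "Q \<equiv> {loc_frac R S a s | a s. a \<in> P \<and> s \<in> S}"
  shows "primeideal Q L" "contraction Q = P"
proof -
  interpret P: primeideal P R by fact
  interpret L: cring L by (rule localization_cring)
  \<comment> \<open>Membership does not depend on the representative: from
    \<open>u a t = u b s\<close> with \<open>b\<close> in \<open>P\<close> the left side is in the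
    prime \<open>P\<close>, while \<open>u\<close> and \<open>t\<close> are not, as \<open>S\<close>
    misses \<open>P\<close>.\<close>
  have mem: "loc_frac R S a s \<in> Q \<longleftrightarrow> a \<in> P" if a: "a \<in> carrier R" "s \<in> S" for a s
  proof
    assume "loc_frac R S a s \<in> Q"
    then obtain b t where b: "loc_frac R S a s = loc_frac R S b t" "b \<in> P" "t \<in> S"
      by (auto simp: Q_def)
    have bc: "b \<in> carrier R" using b(2) P.Icarr by blast
    then obtain u where u: "u \<in> S" "u \<otimes> (a \<otimes> t) = u \<otimes> (b \<otimes> s)"
      using b a loc_frac_iff[OF a bc b(3)] by blast
    have "u \<otimes> (b \<otimes> s) \<in> P"
      by (rule P.I_l_closed[OF P.I_r_closed[OF b(2)]]) (use a u in auto)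
    then have "u \<otimes> (a \<otimes> t) \<in> P" using u by simp
    moreover have "u \<notin> P" "t \<notin> P" using disj u b by auto
    ultimately show "a \<in> P" using P.I_prime[of u "a \<otimes> t"] P.I_prime[of a t] a u b by auto
  next
    assume "a \<in> P"
    then show "loc_frac R S a s \<in> Q" using a by (auto simp: Q_def)
  qed
  have QL: "Q \<subseteq> carrier L" using P.Icarr by (auto simp: Q_def)
  have QE: thesis' if "A \<in> Q" "\<And>a s. \<lbrakk>A = loc_frac R S a s; a \<in> P; a \<in> carrier R; s \<in> S\<rbrakk> \<Longrightarrow> thesis'"
    for A thesis'
    using that P.Icarr by (auto simp: Q_def)
  have mult: "B \<otimes>\<^bsub>L\<^esub> A \<in> Q" if A: "A \<in> Q" and B: "B \<in> carrier L" for A B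
  proof -
    obtain a s where a: "A = loc_frac R S a s" "a \<in> P" "a \<in> carrier R" "s \<in> S" using QE[OF A] by blast
    obtain b t where b: "B = loc_frac R S b t" "b \<in> carrier R" "t \<in> S"
      using localization_carrierE[OF B] by metis
    have "b \<otimes> a \<in> P" using P.I_l_closed a b by blast
    then show ?thesis using a b mem by (simp add: localization_mult)
  qed
  have add: "A \<oplus>\<^bsub>L\<^esub> B \<in> Q" if A: "A \<in> Q" and B: "B \<in> Q" for A B
  proof -
    obtain a s where a: "A = loc_frac R S a s" "a \<in> P" "a \<in> carrier R" "s \<in> S" using QE[OF A] by blast
    obtain b t where b: "B = loc_frac R S b t" "b \<in> P" "b \<in> carrier R" "t \<in> S" using QE[OF B] by blast
    have "a \<otimes> t \<oplus> b \<otimes> s \<in> P" using a b by (intro P.a_closed P.I_r_closed) auto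
    then show ?thesis using a b mem by (simp add: localization_add)
  qed
  have "ideal Q L"
  proof (rule idealI[OF L.ring_axioms])
    show "subgroup Q (add_monoid L)"
    proof (rule L.add.subgroupI)
      show "Q \<subseteq> carrier L" by (fact QL)
      show "Q \<noteq> {}" using mem[of \<zero> \<one>] by auto
      fix A assume A: "A \<in> Q"
      then have Ac: "A \<in> carrier L" using QL by blast
      have "\<ominus>\<^bsub>L\<^esub> A = (\<ominus>\<^bsub>L\<^esub> \<one>\<^bsub>L\<^esub>) \<otimes>\<^bsub>L\<^esub> A" using Ac by (simp add: L.l_minus)
      then show "\<ominus>\<^bsub>L\<^esub> A \<in> Q" using mult[OF A, of "\<ominus>\<^bsub>L\<^esub> \<one>\<^bsub>L\<^esub>"] by simp
      show "A \<oplus>\<^bsub>L\<^esub> B \<in> Q" if "B \<in> Q" for B using add[OF A that] .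
    qed
    show "B \<otimes>\<^bsub>L\<^esub> A \<in> Q" "A \<otimes>\<^bsub>L\<^esub> B \<in> Q" if "A \<in> Q" "B \<in> carrier L" for A B
      using mult[OF that] L.m_comm[of A B] that QL by auto
  qed
  moreover have "\<one>\<^bsub>L\<^esub> \<notin> Q"
    using mem[of \<one> \<one>] disj one_closed by (auto simp: localization_one)
  ultimately show "primeideal Q L"
  proof (intro primeidealI localization_cring)
    fix A B assume A: "A \<in> carrier L" and B: "B \<in> carrier L" and AB: "A \<otimes>\<^bsub>L\<^esub> B \<in> Q"
    obtain a s where a: "A = loc_frac R S a s" "a \<in> carrier R" "s \<in> S"
      using localization_carrierE[OF A] by metis
    obtain b t where b: "B = loc_frac R S b t" "b \<in> carrier R" "t \<in> S"
      using localization_carrierE[OF B] by metis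
    have "a \<otimes> b \<in> P" using AB a b mem by (simp add: localization_mult)
    then show "A \<in> Q \<or> B \<in> Q" using a b mem P.I_prime[OF a(2) b(2)] by simp
  qed auto
  show "contraction Q = P" using mem P.Icarr by (auto simp: loc_map_def)
qed

lemma not_submaximal_localization:
  assumes semi: "semi_local L" and nsub: "\<not> submaximal L"
  shows "loc_spec_finite_min_max R S"
proof -
  interpret L: cring L by (rule localization_cring)
  interpret h: ring_hom_cring R L "loc_map R S" by (rule loc_map_ring_hom_cring)
  note LT = localization_cring semi nsub
  have Spec: "Spec L = MaxSpec L"
    using not_submaximal_prime_maximal[OF LT] L.maximalideal_prime by (auto simp: Spec_def MaxSpec_def)
  have maxim: "maximalideal (contraction Q) R" if Q: "Q \<in> MaxSpec L" for Q
  proof -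
    have Qm: "maximalideal Q L" using Q by (simp add: MaxSpec_def)
    then have Qp: "primeideal Q L" by (rule L.maximalideal_prime)
    interpret Q: primeideal Q L by fact
    obtain K :: "(('a \<times> 'a) set set \<times> ('a \<times> 'a) set set) set ring" and k
      where K: "field K" and k: "k \<in> ring_hom L K"
        and ker: "\<And>a. a \<in> carrier L \<Longrightarrow> k a = \<zero>\<^bsub>K\<^esub> \<longleftrightarrow> a \<in> Q"
      using Q.residue_field by metis
    interpret K: field K by fact
    interpret k: ring_hom_cring L K k using k by unfold_locales
    have eq1: "k A = \<one>\<^bsub>K\<^esub> \<longleftrightarrow> \<one>\<^bsub>L\<^esub> \<oplus>\<^bsub>L\<^esub> \<ominus>\<^bsub>L\<^esub> A \<in> Q" if A: "A \<in> carrier L" for A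
    proof -
      have "\<one>\<^bsub>L\<^esub> \<oplus>\<^bsub>L\<^esub> \<ominus>\<^bsub>L\<^esub> A \<in> Q \<longleftrightarrow> \<one>\<^bsub>K\<^esub> \<oplus>\<^bsub>K\<^esub> \<ominus>\<^bsub>K\<^esub> k A = \<zero>\<^bsub>K\<^esub>"
        using ker[of "\<one>\<^bsub>L\<^esub> \<oplus>\<^bsub>L\<^esub> \<ominus>\<^bsub>L\<^esub> A"] A by simp
      also have "\<dots> \<longleftrightarrow> \<one>\<^bsub>K\<^esub> = k A"
        using K.r_right_minus_eq[of "\<one>\<^bsub>K\<^esub>" "k A"] A by (simp add: a_minus_def)
      finally show ?thesis by auto
    qed
    show ?thesis
    proof (rule primeideal_maximalI[OF primeideal_contraction[OF Qp]])
      fix a assume a: "a \<in> carrier R" "a \<notin> contraction Q"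
      define x where "x = loc_map R S a"
      have x: "x \<in> carrier L" "x \<notin> Q" using a by (auto simp: x_def)
      obtain z where z: "z \<in> carrier L" "\<one>\<^bsub>L\<^esub> \<ominus>\<^bsub>L\<^esub> z \<otimes>\<^bsub>L\<^esub> x \<in> Q"
        using L.maximalideal_inverse[OF Qm x] by metis
      then have "k (z \<otimes>\<^bsub>L\<^esub> x) = \<one>\<^bsub>K\<^esub>"
        using eq1[of "z \<otimes>\<^bsub>L\<^esub> x"] x by (simp add: a_minus_def del: k.hom_mult)
      then have kz: "k x \<otimes>\<^bsub>K\<^esub> k z = \<one>\<^bsub>K\<^esub>" using x z by (simp add: K.m_comm)
      \<comment> \<open>Taking \<open>U\<close> to be the image of \<open>R\<close> makes the
        inverse of \<open>x\<close> modulo \<open>Q\<close> come from \<open>R\<close>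
        itself.\<close>
      have U: "subring (loc_map R S ` carrier R) L"
        by (rule h.ring.img_is_subring[OF carrier_is_subring])
      have xU: "x \<in> loc_map R S ` carrier R" using a by (simp add: x_def)
      have kx: "k x \<noteq> \<zero>\<^bsub>K\<^esub>" using ker x by simp
      obtain u where u: "u \<in> loc_map R S ` carrier R" "k u \<otimes>\<^bsub>K\<^esub> k x = \<one>\<^bsub>K\<^esub>"
        using not_submaximal_inverse[OF LT K k U xU kx _ z(1) kz] by blast
      obtain r where r: "r \<in> carrier R" "u = loc_map R S r" using u by blast
      have "k (u \<otimes>\<^bsub>L\<^esub> x) = \<one>\<^bsub>K\<^esub>" using u x r by simp
      then have "\<one>\<^bsub>L\<^esub> \<oplus>\<^bsub>L\<^esub> \<ominus>\<^bsub>L\<^esub> (u \<otimes>\<^bsub>L\<^esub> x) \<in> Q"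
        using eq1[of "u \<otimes>\<^bsub>L\<^esub> x"] x r by simp
      then have "\<one> \<ominus> r \<otimes> a \<in> contraction Q"
        using a r by (simp add: a_minus_def x_def)
      then show "\<exists>r\<in>carrier R. \<one> \<ominus> r \<otimes> a \<in> contraction Q" using r by blast
    qed
  qed
  \<comment> \<open>A prime below \<open>contraction Q\<close> misses \<open>S\<close> and thus is
    the contraction of a prime \<open>Q'\<close> contained in \<open>Q\<close>. Every prime of
    \<open>L\<close> is maximal, so \<open>Q' = Q\<close>.\<close>
  have minim: "P = contraction Q"
    if Q: "Q \<in> MaxSpec L" and P: "primeideal P R" "P \<subseteq> contraction Q" for P Q
  proof -
    have Qm: "maximalideal Q L" using Q by (simp add: MaxSpec_def)
    then have Qp: "primeideal Q L" by (rule L.maximalideal_prime)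
    interpret Q: maximalideal Q L by fact
    have disj: "P \<inter> S = {}" using loc_map_notin_prime[OF Qp] P(2) by blast
    define Q' where "Q' = {loc_frac R S a s | a s. a \<in> P \<and> s \<in> S}"
    have Q': "primeideal Q' L" "contraction Q' = P"
      using primeideal_extension[OF P(1) disj] unfolding Q'_def by blast+
    then have m: "maximalideal Q' L" using Spec by (auto simp: Spec_def MaxSpec_def)
    have "Q' \<subseteq> Q"
    proof
      fix A assume "A \<in> Q'"
      then obtain a s where a: "A = loc_frac R S a s" "a \<in> P" "s \<in> S" by (auto simp: Q'_def)
      then have "a \<in> carrier R" "loc_map R S a \<in> Q" using P(2) by auto
      then show "A \<in> Q"
        using a loc_frac_split(1)[of a s] Q.I_r_closed[of "loc_map R S a" "loc_frac R S \<one> s"] by simp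
    qed
    then have "Q = Q'"
      using maximalideal.I_maximal[OF m Q.is_ideal _ Q.a_subset] Q.I_notcarr by blast
    then show ?thesis using Q' by simp
  qed
  define \<M> where "\<M> = contraction ` MaxSpec L"
  have "finite \<M>" using semi by (simp add: \<M>_def semi_local_def)
  moreover have "\<M> \<subseteq> MinSpec R \<inter> MaxSpec R"
  proof
    fix P assume "P \<in> \<M>"
    then obtain Q where Q: "Q \<in> MaxSpec L" "P = contraction Q" by (auto simp: \<M>_def)
    have "P \<in> MinSpec R"
      unfolding MinSpec_def Spec_def
      using minim[OF Q(1)] maximalideal_prime[OF maxim[OF Q(1)]] Q(2) by blast
    then show "P \<in> MinSpec R \<inter> MaxSpec R" using maxim[OF Q(1)] Q(2) by (simp add: MaxSpec_def)
  qed
  moreover have ext: "loc_extension R S (contraction Q) = Q" if "Q \<in> MaxSpec L" for Q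
    using that loc_extension_contraction maximalideal.axioms(1) by (auto simp: MaxSpec_def)
  have "MaxSpec L = {loc_extension R S P | P. P \<in> \<M>}"
  proof
    show "MaxSpec L \<subseteq> {loc_extension R S P | P. P \<in> \<M>}"
    proof
      fix Q assume Q: "Q \<in> MaxSpec L"
      have "contraction Q \<in> \<M>" unfolding \<M>_def by (rule imageI[OF Q])
      then show "Q \<in> {loc_extension R S P | P. P \<in> \<M>}" using ext[OF Q] by (metis (mono_tags, lifting) mem_Collect_eq)
    qed
    show "{loc_extension R S P | P. P \<in> \<M>} \<subseteq> MaxSpec L"
    proof
      fix J assume "J \<in> {loc_extension R S P | P. P \<in> \<M>}"
      then obtain Q where Q: "Q \<in> MaxSpec L" "J = loc_extension R S (contraction Q)"
        unfolding \<M>_def by blast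
      then show "J \<in> MaxSpec L" using ext by simp
    qed
  qed
  ultimately show ?thesis using Spec unfolding loc_spec_finite_min_max_def by blast
qed

text \<open>It suffices to invert each \<open>s\<close> in the image of \<open>R\<close>. Finiteness
  of the set of ideals gives one approximate inverse for all of them, and its error is nilpotent in
  \<open>L\<close>.\<close>

lemma loc_map_surj:
  assumes "loc_spec_finite_min_max R S"
  shows "loc_map R S ` carrier R = carrier L"
proof
  interpret L: cring L by (rule localization_cring)
  interpret h: ring_hom_cring R L "loc_map R S" by (rule loc_map_ring_hom_cring)
  show "loc_map R S ` carrier R \<subseteq> carrier L" by auto
  obtain \<M> where M: "finite \<M>" "\<M> \<subseteq> MinSpec R \<inter> MaxSpec R" "Spec L = MaxSpec L"
    "MaxSpec L = {loc_extension R S P | P. P \<in> \<M>}"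
    using assms unfolding loc_spec_finite_min_max_def by blast
  have ext: "loc_map R S p \<in> loc_extension R S P" if P: "P \<in> \<M>" and p: "p \<in> P" for p P
  proof -
    have "maximalideal P R" using M(2) P by (auto simp: MaxSpec_def)
    then interpret P: maximalideal P R .
    have "loc_map R S ` P \<subseteq> carrier L" using P.Icarr by auto
    then show ?thesis using L.genideal_self p unfolding loc_extension_def by blast
  qed
  have U: "subring (loc_map R S ` carrier R) L"
    by (rule h.ring.img_is_subring[OF carrier_is_subring])
  show "carrier L \<subseteq> loc_map R S ` carrier R"
  proof
    fix A assume "A \<in> carrier L"
    then obtain b s where b: "A = loc_frac R S b s" "b \<in> carrier R" "s \<in> S"
      using localization_carrierE by metis
    \<comment> \<open>The extension of \<open>P\<close> is a prime ideal of \<open>L\<close>, hence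
      contains none of the units coming from \<open>S\<close>.\<close>
    have "s \<notin> P" if P: "P \<in> \<M>" for P
    proof
      assume "s \<in> P"
      then have "loc_map R S s \<in> loc_extension R S P" using ext P by blast
      moreover have "primeideal (loc_extension R S P) L" using M(3,4) P by (auto simp: Spec_def)
      ultimately show False using loc_map_notin_prime b(3) by blast
    qed
    then obtain a where a: "a \<in> carrier R" "\<And>P. P \<in> \<M> \<Longrightarrow> \<one> \<ominus> a \<otimes> s \<in> P"
      using maximalideals_common_inverse[OF M(1) _ S_carr[OF b(3)]] M(2) by (metis Int_subset_iff)
    have sc: "s \<in> carrier R" using b(3) by simp
    define q where "q = \<one>\<^bsub>L\<^esub> \<ominus>\<^bsub>L\<^esub> loc_map R S a \<otimes>\<^bsub>L\<^esub> loc_map R S s"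
    have q: "q \<in> carrier L" "q = loc_map R S (\<one> \<ominus> a \<otimes> s)"
      using a(1) sc by (simp_all add: q_def a_minus_def)
    \<comment> \<open>Every prime of \<open>L\<close> is extended from some \<open>P\<close> in the
      finite set, and \<open>q\<close> is the image of \<open>1 - a s\<close>, which lies in each
      such \<open>P\<close>.\<close>
    have "q \<in> Q" if "primeideal Q L" for Q
    proof -
      have "Q \<in> MaxSpec L" using that M(3) by (auto simp: Spec_def)
      then obtain P where P: "P \<in> \<M>" "Q = loc_extension R S P" using M(4) by blast
      then show ?thesis using ext[OF P(1) a(2)[OF P(1)]] q(2) by simp
    qed
    then obtain n :: nat where "q [^]\<^bsub>L\<^esub> n = \<zero>\<^bsub>L\<^esub>" using L.in_all_primes_nilpotent[OF q(1)] by blast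
    then obtain e where e: "e \<in> loc_map R S ` carrier R" "e \<otimes>\<^bsub>L\<^esub> loc_map R S s = \<one>\<^bsub>L\<^esub>"
      using L.subring_inverse_of_nilpotent[OF U imageI[OF sc] imageI[OF a(1)]] unfolding q_def by blast
    have eL: "e \<in> carrier L" using e(1) subringE(1)[OF U] by blast
    have AL: "A \<in> carrier L" using b by simp
    have sL: "loc_map R S s \<in> carrier L" using sc by simp
    have "A = A \<otimes>\<^bsub>L\<^esub> (e \<otimes>\<^bsub>L\<^esub> loc_map R S s)" using e(2) AL by simp
    also have "\<dots> = (A \<otimes>\<^bsub>L\<^esub> loc_map R S s) \<otimes>\<^bsub>L\<^esub> e" using AL eL sL by (simp add: L.m_ac)
    also have "A \<otimes>\<^bsub>L\<^esub> loc_map R S s = loc_map R S b" using loc_frac_split(2)[OF b(2,3)] b(1) by simp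
    finally show "A \<in> loc_map R S ` carrier R"
      using subringE(6)[OF U imageI[OF b(2)] e(1)] by simp
  qed
qed

end

theorem theorem1p32:
  fixes R :: "('a, 'b) ring_scheme" and S :: "'a set"
  assumes "cring R" and "\<one>\<^bsub>R\<^esub> \<noteq> \<zero>\<^bsub>R\<^esub>"
    and "submonoid S R"
    and "\<one>\<^bsub>localization R S\<^esub> \<noteq> \<zero>\<^bsub>localization R S\<^esub>"
    and "semi_local (localization R S)"
  shows "(submaximal (localization R S) \<or> loc_spec_finite_min_max R S) \<and>
    (loc_spec_finite_min_max R S \<and> submaximal (localization R S) \<longrightarrow> submaximal R)"
proof -
  interpret mult_closed R S using assms(1,3) by (rule mult_closed.intro)
  show ?thesis
    using not_submaximal_localization[OF assms(5)]
      submaximal_surjective_hom[OF ring_axioms cring.axioms(1)[OF localization_cring] loc_map_hom]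
      loc_map_surj by blast
qed

end
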